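(* Let $k\in(0,3)$ and $x\in(0,\pi/2)$, and write $M_k(t;q)=\left(1-\frac k3+\frac k3 t^{q}\right)^{1/(kq)}$ for $t\in(0,1)$ ($M_k(t;0)=t^{1/3}$). (i) If $k\in[\frac75,3)$, then $\frac{\sin x}{x}<M_k(\cos x;q)$ holds for all $x\in(0,\pi/2)$ if and only if $q\ge\frac{8}{5(3-k)}$. (ii) If $k\in(p_0,3)$, then $M_k(\cos x;q)<\frac{\sin x}{x}$ holds for all $x\in(0,\pi/2)$ if and only if $q\le\frac{\ln(1-k/3)}{k\ln(2/\pi)}$. (iii) If $k\in(0,\frac{23}{17}]$, then $M_k(\cos x;q)<\frac{\sin x}{x}$ holds for all $x\in(0,\pi/2)$ if and only if $q\le\frac{8}{5(3-k)}$. (iv) If $k\in(0,p_0^* )$, then $\frac{\sin x}{x}<M_k(\cos x;q)$ holds for all $x\in(0,\pi/2)$ if and only if $q\ge\frac{\ln(1-k/3)}{k\ln(2/\pi)}$.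
   Context: $p_0\approx1.42034$ is the unique real $p$ with $\frac{p}{3(1-(2/\pi)^p)}=1$, and $p_0^*\approx1.27754$ is the unique real $p$ with $\frac{p}{3(1-(2/\pi)^p)}=\frac{34}{35}$. *)

theory Defs
  imports Complex_Main
begin

definition M :: "real \<Rightarrow> real \<Rightarrow> real \<Rightarrow> real" where
  "M k t q = (if q = 0 then t powr (1/3)
              else (1 - k/3 + k/3 * t powr q) powr (1 / (k * q)))"

definition p0 :: real where
  "p0 = (THE p. p / (3 * (1 - (2/pi) powr p)) = 1)"

definition p0_star :: real where
  "p0_star = (THE p. p / (3 * (1 - (2/pi) powr p)) = 34/35)"

end

(* Put p = k q. Then sin x / x < M_k(cos x; q) means that
     G(x) = (1 - (sin x / x)^p) / p - (1 - cos^q x) / (3 q)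
   is positive. Up to a positive factor G' is exp(L) - 1, where L tends to 0 at 0 and L' is a
   positive multiple of
     S(x) = R(x) - (p - 1) + (q - 1) T(x)
   with explicit functions R and T that do not depend on p and q. Two inequalities for
   trigonometric polynomials, read off from alternating power series, show that R is increasing
   and R - T/35 is decreasing; hence T is increasing, and S is increasing for q >= 1 and
   decreasing for q <= 34/35.
   At 0 the function S tends to 3 q - p - 8/5, which vanishes for q = 8 / (5 (3 - k)); there S
   has a constant sign, and so has G. For q = ln(1 - k/3) / (k ln(2/pi)) the function G vanishes
   at both ends of the interval and is unimodal because S is monotone, so it has a constant sign
   again; p0 and p0_star enter only through q > 1 and q < 34/35. All other q are reached since
   M_k is increasing in q, and necessity is the behaviour of G near 0 and near pi/2. *)
theory Submission
  imports Defs "HOL-Analysis.Convex" "HOL-Real_Asymp.Real_Asymp"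
begin

section \<open>Alternating power series\<close>

text \<open>All series share the prefix \<open>(-1)^n * x^(2*n) / fact (2*n)\<close>, so that a
  linear combination of functions becomes one of coefficient sequences.\<close>

lemma sums_cos_mult:
  fixes m x :: real
  shows "(\<lambda>n. (-1)^n * x^(2*n) / fact (2*n) * (m^2)^n) sums cos (m * x)"
proof -
  have "(-1)^n / fact (2*n) * (m * x)^(2*n) = (-1)^n * x^(2*n) / fact (2*n) * (m^2)^n" for n
    by (simp add: power_mult_distrib power_mult[of m 2 n])
  thus ?thesis
    using cos_paired[of "m * x"] by (simp only:)
qed

lemma sums_x_sin_mult:
  fixes m x :: real
  assumes "m \<noteq> 0"
  shows "(\<lambda>n. (-1)^n * x^(2*n) / fact (2*n) * (- (2 * real n) / m * (m^2)^n)) sums (x * sin (m * x))"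
proof (rule sums_Suc_imp)
  have "(-1)^Suc n * x^(2 * Suc n) / fact (2 * Suc n) * (- (2 * real (Suc n)) / m * (m^2)^Suc n)
      = x * ((-1)^n / fact (2*n+1) * (m * x)^(2*n+1))" for n
  proof -
    have "fact (2 * Suc n) = 2 * real (Suc n) * fact (2*n+1)"
      by simp
    moreover have "(m^2)^Suc n = m * m^(2*n+1)"
      by (simp only: power_mult [symmetric]) simp
    moreover have "(m * x)^(2*n+1) = m^(2*n+1) * x^(2*n+1)" "x^(2 * Suc n) = x * x^(2*n+1)"
      by (simp_all only: power_mult_distrib) simp
    moreover have "(fact (2*n+1) :: real) \<noteq> 0" "2 * real (Suc n) \<noteq> 0"
      by simp_all
    ultimately show ?thesis
      using assms by (simp add: field_simps del: fact_Suc of_nat_Suc power_Suc) simp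
  qed
  thus "(\<lambda>n. (-1)^Suc n * x^(2 * Suc n) / fact (2 * Suc n) * (- (2 * real (Suc n)) / m * (m^2)^Suc n))
      sums (x * sin (m * x))"
    using sums_mult[OF sin_paired[of "m * x"], of x] by (simp only:)
qed simp

text \<open>Multiplying by \<open>x^2\<close> shifts the index by one. At \<open>n = 0\<close> the
  truncated \<open>n - 1\<close> is harmless, because the factor \<open>2 * real n\<close>
  vanishes.\<close>

lemma sums_x2_mult:
  fixes x S :: real and g :: "nat \<Rightarrow> real"
  assumes "(\<lambda>n. (-1)^n * x^(2*n) / fact (2*n) * g n) sums S"
  shows "(\<lambda>n. (-1)^n * x^(2*n) / fact (2*n) * (- (2 * real n) * (2 * real n - 1) * g (n - 1)))
           sums (x^2 * S)"
proof (rule sums_Suc_imp)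
  have "(-1)^Suc n * x^(2 * Suc n) / fact (2 * Suc n)
          * (- (2 * real (Suc n)) * (2 * real (Suc n) - 1) * g (Suc n - 1))
      = x^2 * ((-1)^n * x^(2*n) / fact (2*n) * g n)" for n
  proof -
    have "fact (2 * Suc n) = (2 * real (Suc n)) * (2 * real (Suc n) - 1) * fact (2*n)"
      by simp
    moreover have "2 * real (Suc n) \<noteq> 0" "2 * real (Suc n) - 1 \<noteq> 0"
      by simp_all
    ultimately show ?thesis
      by (simp add: power2_eq_square del: fact_Suc of_nat_Suc)
  qed
  thus "(\<lambda>n. (-1)^Suc n * x^(2 * Suc n) / fact (2 * Suc n)
          * (- (2 * real (Suc n)) * (2 * real (Suc n) - 1) * g (Suc n - 1))) sums (x^2 * S)"
    using sums_mult[OF assms, of "x^2"] by (simp only:)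
qed simp

lemma sums_x2_cos_mult:
  fixes m x :: real
  assumes "m \<noteq> 0"
  shows "(\<lambda>n. (-1)^n * x^(2*n) / fact (2*n) * (- (2 * real n) * (2 * real n - 1) / m^2 * (m^2)^n))
           sums (x^2 * cos (m * x))"
proof -
  have "2 * real n * (m^2)^(n - 1) = 2 * real n / m^2 * (m^2)^n" for n
    using assms by (cases n) simp_all
  hence "- (2 * real n) * (2 * real n - 1) * (m^2)^(n - 1)
           = - (2 * real n) * (2 * real n - 1) / m^2 * (m^2)^n" for n
    using assms by (cases n) simp_all
  thus ?thesis
    using sums_x2_mult[OF sums_cos_mult[of x m]] by (simp only:)
qed

lemma sums_x3_sin_mult:
  fixes m x :: real
  assumes "m \<noteq> 0"
  shows "(\<lambda>n. (-1)^n * x^(2*n) / fact (2*n)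
             * (2 * real n * (2 * real n - 1) * (2 * real n - 2) / m^3 * (m^2)^n))
           sums (x^3 * sin (m * x))"
proof -
  have "- (2 * real n) * (2 * real n - 1) * (- (2 * real (n - 1)) / m * (m^2)^(n - 1))
           = 2 * real n * (2 * real n - 1) * (2 * real n - 2) / m^3 * (m^2)^n" for n
    using assms by (cases n) (simp_all add: power2_eq_square power3_eq_cube, simp add: field_simps)
  thus ?thesis
    using sums_x2_mult[OF sums_x_sin_mult[OF assms, of x]]
    by (simp only: power3_eq_cube power2_eq_square mult.assoc)
qed

text \<open>From \<open>N\<close> on, the terms are added in consecutive pairs, each of them
  nonnegative.\<close>

lemma sums_ge_partial_sum:
  fixes f :: "nat \<Rightarrow> real"
  assumes "f sums S" and "\<And>j. 0 \<le> f (N + 2*j) + f (Suc (N + 2*j))"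
  shows "sum f {..<N} \<le> S"
proof -
  have "(\<lambda>n. f (n + N)) sums (S - sum f {..<N})"
    using assms(1) sums_iff_shift[of f N "S - sum f {..<N}"] by simp
  from sums_group[OF this, of 2]
  have "(\<lambda>n. \<Sum>i\<in>{n * 2..<n * 2 + 2}. f (i + N)) sums (S - sum f {..<N})"
    by simp
  moreover have "(\<Sum>i\<in>{n * 2..<n * 2 + 2}. f (i + N)) = f (N + 2*n) + f (Suc (N + 2*n))" for n
  proof -
    have "{n * 2..<n * 2 + 2} = {n * 2, Suc (n * 2)}" by auto
    thus ?thesis by (simp add: algebra_simps)
  qed
  ultimately have "(\<lambda>n. f (N + 2*n) + f (Suc (N + 2*n))) sums (S - sum f {..<N})"
    by (simp only:)
  from sums_le[OF assms(2) sums_zero this] have "0 \<le> S - sum f {..<N}" .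
  thus ?thesis by simp
qed

text \<open>The factor \<open>(-1)^N\<close> cancels the sign at the first index of each pair of the
  tail; the growth condition keeps the second term of a pair from outweighing the first.\<close>

lemma alternating_ge_partial_sum:
  fixes h :: "nat \<Rightarrow> real"
  assumes "(\<lambda>n. (-1)^n * x^(2*n) / fact (2*n) * ((-1)^N * h n)) sums S"
    and "\<And>n. N \<le> n \<Longrightarrow> h (Suc n) * x\<^sup>2 \<le> (2 * real n + 2) * (2 * real n + 1) * h n"
  shows "(\<Sum>n<N. (-1)^n * x^(2*n) / fact (2*n) * ((-1)^N * h n)) \<le> S"
proof (rule sums_ge_partial_sum[OF assms(1)])
  fix j
  define n where "n = N + 2*j"
  have "N \<le> n" by (simp add: n_def)
  have par: "(-1)^n * (-1)^N = (1::real)"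
    unfolding n_def by (simp add: power_add power_mult flip: power_mult_distrib)
  have fact_eq: "fact (2 * Suc n) = (2 * real n + 2) * (2 * real n + 1) * fact (2*n)"
    by (simp add: algebra_simps)
  define c where "c = (2 * real n + 2) * (2 * real n + 1)"
  have c: "c > 0" unfolding c_def by (intro mult_pos_pos) auto
  have "(-1)^n * x^(2*n) / fact (2*n) * ((-1)^N * h n) = x^(2*n) / fact (2*n) * h n"
  proof -
    have "(-1)^n * x^(2*n) / fact (2*n) * ((-1)^N * h n) = ((-1)^n * (-1)^N) * x^(2*n) / fact (2*n) * h n"
      by simp
    thus ?thesis unfolding par by simp
  qed
  moreover have "(-1)^Suc n * x^(2 * Suc n) / fact (2 * Suc n) * ((-1)^N * h (Suc n))
      = - (x^(2*n) / fact (2*n)) * (h (Suc n) * x\<^sup>2 / c)"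
  proof -
    have "(-1)^Suc n * x^(2 * Suc n) / fact (2 * Suc n) * ((-1)^N * h (Suc n))
      = - ((-1)^n * (-1)^N) * x^(2 * Suc n) / fact (2 * Suc n) * h (Suc n)" by simp
    also have "\<dots> = - (x^(2*n) / fact (2*n)) * (h (Suc n) * x\<^sup>2 / c)"
      unfolding par fact_eq c_def[symmetric] by (simp add: power2_eq_square mult_ac)
    finally show ?thesis .
  qed
  moreover have "h (Suc n) * x\<^sup>2 / c \<le> h n"
    using assms(2)[of n, folded c_def] c \<open>N \<le> n\<close> by (simp add: pos_divide_le_eq mult.commute[of _ c])
  hence "x^(2*n) / fact (2*n) * (h (Suc n) * x\<^sup>2 / c) \<le> x^(2*n) / fact (2*n) * h n"
    by (intro mult_left_mono) (simp_all add: power_mult)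
  ultimately show "0 \<le> (-1)^(N + 2*j) * x^(2*(N + 2*j)) / fact (2*(N + 2*j)) * ((-1)^N * h (N + 2*j))
    + (-1)^Suc (N + 2*j) * x^(2*Suc (N + 2*j)) / fact (2*Suc (N + 2*j)) * ((-1)^N * h (Suc (N + 2*j)))"
    unfolding n_def[symmetric] by linarith
qed

section \<open>Two trigonometric inequalities\<close>

lemma sin_3x: "sin (3 * x) = sin x * (4 * cos x ^ 2 - 1)" for x :: real
proof -
  have "sin (3 * x) = sin (2 * x + x)" by (simp add: algebra_simps)
  thus ?thesis
    unfolding sin_add[of "2 * x" x] sin_double cos_double_cos by algebra
qed

lemma cos_3x: "cos (3 * x) = 4 * cos x ^ 3 - 3 * cos x" for x :: real
  by (rule cos_treble_cos)

lemma sin_5x: "sin (5 * x) = sin x * (16 * cos x ^ 4 - 12 * cos x ^ 2 + 1)" for x :: real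
proof -
  have "sin (5 * x) = sin (3 * x + 2 * x)" by (simp add: algebra_simps)
  thus ?thesis
    unfolding sin_add sin_3x cos_3x sin_double cos_double_cos by algebra
qed

lemma cos_5x: "cos (5 * x) = 16 * cos x ^ 5 - 20 * cos x ^ 3 + 5 * cos x" for x :: real
proof -
  have "cos (5 * x) = cos (3 * x + 2 * x)" by (simp add: algebra_simps)
  also have "\<dots> = (4 * cos x ^ 3 - 3 * cos x) * (2 * cos x ^ 2 - 1)
      - (sin x)\<^sup>2 * (4 * cos x ^ 2 - 1) * (2 * cos x)"
    unfolding cos_add sin_3x cos_3x sin_double cos_double_cos by algebra
  finally show ?thesis
    unfolding sin_squared_eq by algebra
qed

lemma pi_ge_3: "3 \<le> pi"
  using sin_x_le_x[of "pi/6"] by (simp add: sin_30)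

text \<open>\<open>cos (8/5)\<close> is negative, since its Taylor polynomial of degree 4, an upper
  bound, already is; hence \<open>pi/2 < 8/5\<close>.\<close>

lemma pi_less_16_5: "pi < 16/5"
proof (rule ccontr)
  assume "\<not> pi < 16/5"
  hence "0 \<le> cos (8/5 :: real)"
    by (intro cos_ge_zero) auto
  have "(\<lambda>n. (-1)^n * (8/5)^(2*n) / fact (2*n) * ((-1)^3 * (1::real))) sums (- cos (1 * (8/5)))"
    using sums_minus[OF sums_cos_mult[of "8/5" 1]] by simp
  hence "(\<Sum>n<3. (-1)^n * (8/5)^(2*n) / fact (2*n) * ((-1)^3 * (1::real))) \<le> - cos (1 * (8/5))"
  proof (rule alternating_ge_partial_sum)
    fix n :: nat assume "3 \<le> n"
    hence "(2 * real n + 2) * (2 * real n + 1) \<ge> (2 * 3 + 2) * (2 * 3 + 1)"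
      by (intro mult_mono) auto
    thus "1 * (8/5 :: real)\<^sup>2 \<le> (2 * real n + 2) * (2 * real n + 1) * 1"
      by (simp add: power2_eq_square)
  qed
  moreover have "(\<Sum>n<3. (-1)^n * (8/5)^(2*n) / fact (2*n) * ((-1)^3 * (1::real))) > 0"
    by (simp add: lessThan_nat_numeral lessThan_Suc power_divide fact_numeral)
  ultimately show False
    using \<open>0 \<le> cos (8/5)\<close> by simp
qed

lemma square_less_of_less_pi_half:
  assumes "0 < x" "x < pi/2"
  shows "x\<^sup>2 < 64/25"
proof -
  have "x < 8/5" using assms pi_less_16_5 by simp
  hence "x\<^sup>2 < (8/5)\<^sup>2" using assms by (intro power_strict_mono) auto
  thus ?thesis by (simp add: power2_eq_square)
qed

text \<open>The numerators of the derivatives of \<open>ratio_R\<close> and of \<open>ratio_R - ratio_T / 35\<close>, defined below.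
  They vanish at 0 to order 10 and 12: the factor 1/35 is the one that cancels the \<open>x^10\<close> term.\<close>
definition numer_R :: "real \<Rightarrow> real" where
  "numer_R x = 6 * x * sin x - x * sin x ^ 3 - 2 * x^3 * sin x - 3 * x^2 * cos x - 3 * sin x ^ 2 * cos x"

definition numer_RT :: "real \<Rightarrow> real" where
  "numer_RT x = x * (210 * sin x * cos x ^ 2 - 34 * sin x ^ 3 * cos x ^ 2 - sin x ^ 3)
     + x^2 * (3 * sin x ^ 2 * cos x - 105 * cos x ^ 3) - 72 * x^3 * sin x * cos x ^ 2
     - 105 * sin x ^ 2 * cos x ^ 3 - sin x ^ 4 * cos x"

text \<open>Products are linearised so that each summand is a power of \<open>x\<close> times one
  sine or cosine with a known series. The form \<open>sin (1 * x)\<close> matches the general lemmas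
  at \<open>m = 1\<close>.\<close>

lemma numer_R_multiple_angles:
  "numer_R x = 21/4 * (x * sin (1 * x)) + 1/4 * (x * sin (3 * x)) - 2 * (x^3 * sin (1 * x))
     - 3 * (x^2 * cos (1 * x)) + 3/4 * cos (3 * x) - 3/4 * cos (1 * x)"
proof -
  have "sin x ^ 3 = sin x * (1 - cos x ^ 2)"
    unfolding sin_squared_eq [symmetric] by (simp add: power3_eq_cube power2_eq_square)
  thus ?thesis
    unfolding numer_R_def sin_3x cos_3x sin_squared_eq mult_1 by algebra
qed

lemma numer_RT_multiple_angles:
  "numer_RT x = 405/8 * (x * sin (3 * x)) + 95/2 * (x * sin (1 * x)) + 17/8 * (x * sin (5 * x))
     - 27 * (x^2 * cos (3 * x)) - 78 * (x^2 * cos (1 * x)) - 18 * (x^3 * sin (3 * x))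
     - 18 * (x^3 * sin (1 * x)) + 13/2 * cos (5 * x) + 27/4 * cos (3 * x) - 53/4 * cos (1 * x)"
proof -
  have "sin x ^ 3 = sin x * (1 - cos x ^ 2)"
    unfolding sin_squared_eq [symmetric] by (simp add: power3_eq_cube power2_eq_square)
  moreover have "sin x ^ 4 = (1 - cos x ^ 2)^2"
    by (simp add: sin_squared_eq [symmetric])
  ultimately show ?thesis
    unfolding numer_RT_def sin_3x cos_3x sin_5x cos_5x sin_squared_eq mult_1 by algebra
qed

text \<open>The Taylor coefficients obtained from the multiple-angle forms, up to \<open>(2n)!\<close> and an
  alternating sign; they vanish for \<open>n < 5\<close> and \<open>n < 6\<close> respectively.\<close>
definition coeff_R :: "nat \<Rightarrow> real" where
  "coeff_R n = (let r = real n in 9^n * (r/6 - 3/4) + (16 * r^3 - 36 * r^2 + 49/2 * r + 3/4))"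

definition coeff_RT :: "nat \<Rightarrow> real" where
  "coeff_RT n = (let r = real n in 25^n * (17/20 * r - 13/2)
     + 9^n * (- 27/4 + 135/4 * r - 6 * r * (2*r - 1) + 2/3 * (2*r) * (2*r-1) * (2*r-2))
     + (53/4 + 95 * r - 78 * (2*r) * (2*r-1) + 18 * (2*r) * (2*r-1) * (2*r-2)))"

section \<open>Power series and signs of the two numerators\<close>

lemma numer_R_sums: "(\<lambda>n. (-1)^n * x^(2*n) / fact (2*n) * ((-1)^7 * coeff_R n)) sums numer_R x"
proof -
  have *: "21/4 * ((-1)^n * x^(2*n) / fact (2*n) * (- (2 * real n) / 1 * (1^2)^n))
   + 1/4 * ((-1)^n * x^(2*n) / fact (2*n) * (- (2 * real n) / 3 * (3^2)^n))
   - 2 * ((-1)^n * x^(2*n) / fact (2*n) * (2 * real n * (2 * real n - 1) * (2 * real n - 2) / 1^3 * (1^2)^n))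
   - 3 * ((-1)^n * x^(2*n) / fact (2*n) * (- (2 * real n) * (2 * real n - 1) / 1^2 * (1^2)^n))
   + 3/4 * ((-1)^n * x^(2*n) / fact (2*n) * (3^2)^n)
   - 3/4 * ((-1)^n * x^(2*n) / fact (2*n) * (1^2)^n)
   = (-1)^n * x^(2*n) / fact (2*n) * ((-1)^7 * coeff_R n)" (is "?l n = ?r n") for n
  proof -
    \<comment> \<open>With variables for the common prefix, the index and the power of 9, comparing
      coefficients is a polynomial identity.\<close>
    have "21/4 * (E * (- (2 * r) / 1 * 1)) + 1/4 * (E * (- (2 * r) / 3 * q))
     - 2 * (E * (2 * r * (2 * r - 1) * (2 * r - 2) / 1 * 1))
     - 3 * (E * (- (2 * r) * (2 * r - 1) / 1 * 1)) + 3/4 * (E * q) - 3/4 * (E * 1)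
     = E * (- (q * (r/6 - 3/4) + (16 * r^3 - 36 * r^2 + 49/2 * r + 3/4)))" for E r q :: real
      by (simp add: algebra_simps power3_eq_cube power2_eq_square)
    from this[of "(-1)^n * x^(2*n) / fact (2*n)" "real n" "9^n"] show ?thesis
      by (simp add: coeff_R_def Let_def)
  qed
  have "?l sums numer_R x"
    unfolding numer_R_multiple_angles
    by (intro sums_add sums_diff sums_mult sums_cos_mult sums_x_sin_mult sums_x2_cos_mult sums_x3_sin_mult)
       simp_all
  thus ?thesis unfolding * .
qed

lemma numer_RT_sums: "(\<lambda>n. (-1)^n * x^(2*n) / fact (2*n) * ((-1)^10 * coeff_RT n)) sums (- numer_RT x)"
proof -
  have *: "-(405/8 * ((-1)^n * x^(2*n) / fact (2*n) * (- (2 * real n) / 3 * (3^2)^n))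
   + 95/2 * ((-1)^n * x^(2*n) / fact (2*n) * (- (2 * real n) / 1 * (1^2)^n))
   + 17/8 * ((-1)^n * x^(2*n) / fact (2*n) * (- (2 * real n) / 5 * (5^2)^n))
   - 27 * ((-1)^n * x^(2*n) / fact (2*n) * (- (2 * real n) * (2 * real n - 1) / 3^2 * (3^2)^n))
   - 78 * ((-1)^n * x^(2*n) / fact (2*n) * (- (2 * real n) * (2 * real n - 1) / 1^2 * (1^2)^n))
   - 18 * ((-1)^n * x^(2*n) / fact (2*n) * (2 * real n * (2 * real n - 1) * (2 * real n - 2) / 3^3 * (3^2)^n))
   - 18 * ((-1)^n * x^(2*n) / fact (2*n) * (2 * real n * (2 * real n - 1) * (2 * real n - 2) / 1^3 * (1^2)^n))
   + 13/2 * ((-1)^n * x^(2*n) / fact (2*n) * (5^2)^n)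
   + 27/4 * ((-1)^n * x^(2*n) / fact (2*n) * (3^2)^n)
   - 53/4 * ((-1)^n * x^(2*n) / fact (2*n) * (1^2)^n))
   = (-1)^n * x^(2*n) / fact (2*n) * ((-1)^10 * coeff_RT n)" (is "?l n = ?r n") for n
  proof -
    have "-(405/8 * (E * (- (2 * r) / 3 * q)) + 95/2 * (E * (- (2 * r) / 1 * 1))
     + 17/8 * (E * (- (2 * r) / 5 * t)) - 27 * (E * (- (2 * r) * (2 * r - 1) / 9 * q))
     - 78 * (E * (- (2 * r) * (2 * r - 1) / 1 * 1))
     - 18 * (E * (2 * r * (2 * r - 1) * (2 * r - 2) / 27 * q))
     - 18 * (E * (2 * r * (2 * r - 1) * (2 * r - 2) / 1 * 1))
     + 13/2 * (E * t) + 27/4 * (E * q) - 53/4 * (E * 1))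
     = E * (t * (17/20 * r - 13/2)
     + q * (- 27/4 + 135/4 * r - 6 * r * (2*r - 1) + 2/3 * (2*r) * (2*r-1) * (2*r-2))
     + (53/4 + 95 * r - 78 * (2*r) * (2*r-1) + 18 * (2*r) * (2*r-1) * (2*r-2)))" for E r q t :: real
      by (simp add: field_simps)
    from this[of "(-1)^n * x^(2*n) / fact (2*n)" "real n" "9^n" "25^n"] show ?thesis
      by (simp add: coeff_RT_def Let_def)
  qed
  have "?l sums (- numer_RT x)"
    unfolding numer_RT_multiple_angles
    by (intro sums_minus sums_add sums_diff sums_mult sums_cos_mult sums_x_sin_mult sums_x2_cos_mult sums_x3_sin_mult)
       simp_all
  thus ?thesis unfolding * .
qed

text \<open>From \<open>n = 7\<close> on the factor on the right is at least 16 * 15 = 240, while 60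
  * 64/25 = 153.6; hence growth by at most a factor 60 is enough.\<close>

lemma alternating_step:
  fixes h :: "nat \<Rightarrow> real"
  assumes "h (Suc n) \<le> 60 * h n" "0 \<le> h n" "7 \<le> n" "x\<^sup>2 \<le> 64/25"
  shows "h (Suc n) * x\<^sup>2 \<le> (2 * real n + 2) * (2 * real n + 1) * h n"
proof -
  have "h (Suc n) * x\<^sup>2 \<le> (60 * h n) * (64/25)"
    using assms by (intro mult_mono) auto
  also have "\<dots> \<le> ((2 * 7 + 2) * (2 * 7 + 1)) * h n"
    using assms(2) by simp
  also have "\<dots> \<le> (2 * real n + 2) * (2 * real n + 1) * h n"
    using assms by (intro mult_right_mono mult_mono) auto
  finally show ?thesis .
qed

lemma coeff_R_growth:
  assumes "7 \<le> n"
  shows "coeff_R (Suc n) \<le> 60 * coeff_R n" "0 \<le> coeff_R n"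
proof -
  \<comment> \<open>In terms of \<open>m >= 0\<close> the polynomial inequalities have only
    nonnegative coefficients once everything is on one side. The exponential and the polynomial part
    are compared separately.\<close>
  define m where "m = real n - 7"
  have m: "real n = m + 7" "m \<ge> 0" using assms by (auto simp: m_def)
  have pw: "0 \<le> m * m" "0 \<le> m * (m * m)" "0 \<le> m" using m by simp_all
  define P where "P r = 16 * r^3 - 36 * r^2 + 49/2 * r + 3/4" for r :: real
  have P: "P (m+8) \<le> 60 * P (m+7)" "0 \<le> P (m+7)"
    using pw unfolding P_def by (simp_all add: power3_eq_cube power2_eq_square field_simps)
  have L: "9^n * (9 * ((m+8)/6 - 3/4)) \<le> 9^n * (60 * ((m+7)/6 - 3/4))"
    using m(2) by (intro mult_left_mono) (auto simp: field_simps)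
  have L': "0 \<le> 9^n * ((m+7)/6 - 3/4)"
    using m(2) by (intro mult_nonneg_nonneg) (auto simp: field_simps)
  have h: "coeff_R n = 9^n * ((m+7)/6 - 3/4) + P (m+7)"
    unfolding coeff_R_def Let_def m(1) P_def by simp
  have "real (Suc n) = m + 8" using m(1) by simp
  hence h': "coeff_R (Suc n) = 9^n * (9 * ((m+8)/6 - 3/4)) + P (m+8)"
    unfolding coeff_R_def Let_def P_def by (simp only: power_Suc mult_ac)
  have "coeff_R (Suc n) \<le> 9^n * (60 * ((m+7)/6 - 3/4)) + 60 * P (m+7)"
    unfolding h' by (intro add_mono P L)
  also have "\<dots> = 60 * coeff_R n"
    unfolding h by (simp only: distrib_left mult.left_commute)
  finally show "coeff_R (Suc n) \<le> 60 * coeff_R n" .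
  show "0 \<le> coeff_R n"
    unfolding h by (intro add_nonneg_nonneg P L')
qed

lemma coeff_RT_growth:
  assumes "10 \<le> n"
  shows "coeff_RT (Suc n) \<le> 60 * coeff_RT n" "0 \<le> coeff_RT n"
proof -
  define m where "m = real n - 10"
  have m: "real n = m + 10" "m \<ge> 0" using assms by (auto simp: m_def)
  define P where "P r = - 27/4 + 135/4 * r - 6 * r * (2*r - 1) + 2/3 * (2*r) * (2*r-1) * (2*r-2)" for r :: real
  define Q where "Q r = 53/4 + 95 * r - 78 * (2*r) * (2*r-1) + 18 * (2*r) * (2*r-1) * (2*r-2)" for r :: real
  have pw: "0 \<le> m * m" "0 \<le> m * (m * m)" "0 \<le> m" using m by simp_all
  have "Q (m+11) \<le> 60 * Q (m+10)" "0 \<le> Q (m+10)" "9 * P (m+11) \<le> 60 * P (m+10)" "0 \<le> P (m+10)"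
    using pw unfolding P_def Q_def by (simp_all add: field_simps)
  hence P: "9^n * (9 * P (m+11)) \<le> 9^n * (60 * P (m+10))" "0 \<le> 9^n * P (m+10)"
    and Q: "Q (m+11) \<le> 60 * Q (m+10)" "0 \<le> Q (m+10)"
    by simp_all
  have L: "25^n * (25 * (17/20 * (m+11) - 13/2)) \<le> 25^n * (60 * (17/20 * (m+10) - 13/2))"
    using m(2) by (intro mult_left_mono) (auto simp: field_simps)
  have L': "0 \<le> 25^n * (17/20 * (m+10) - 13/2)"
    using m(2) by (intro mult_nonneg_nonneg) (auto simp: field_simps)
  have h: "coeff_RT n = 25^n * (17/20 * (m+10) - 13/2) + 9^n * P (m+10) + Q (m+10)"
    unfolding coeff_RT_def Let_def m(1) P_def Q_def by simp
  have "real (Suc n) = m + 11" using m(1) by simp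
  hence h': "coeff_RT (Suc n) = 25^n * (25 * (17/20 * (m+11) - 13/2)) + 9^n * (9 * P (m+11)) + Q (m+11)"
    unfolding coeff_RT_def Let_def P_def Q_def by (simp only: power_Suc mult_ac)
  have "coeff_RT (Suc n) \<le> 25^n * (60 * (17/20 * (m+10) - 13/2)) + 9^n * (60 * P (m+10)) + 60 * Q (m+10)"
    unfolding h' by (intro add_mono P L Q)
  also have "\<dots> = 60 * coeff_RT n"
    unfolding h by (simp only: distrib_left mult.left_commute)
  finally show "coeff_RT (Suc n) \<le> 60 * coeff_RT n" .
  show "0 \<le> coeff_RT n"
    unfolding h by (intro add_nonneg_nonneg P L' Q)
qed

text \<open>The first two nonzero terms, of orders 10 and 12, have a positive sum as long as
  \<open>x^2 < 6\<close>, and the tail after them is nonnegative.\<close>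

lemma numer_R_pos:
  assumes "0 < x" "x < pi/2"
  shows "0 < numer_R x"
proof -
  have x2: "x\<^sup>2 < 64/25" by (rule square_less_of_less_pi_half[OF assms])
  have "0 < x^10 * (8/4725 - 4/14175 * x\<^sup>2)"
    using x2 assms by (intro mult_pos_pos) auto
  also have "\<dots> = 8/4725 * x^10 - 4/14175 * x^12"
    by (simp add: algebra_simps flip: power_add)
  also have "\<dots> = (\<Sum>n<7. (-1)^n * x^(2*n) / fact (2*n) * ((-1)^7 * coeff_R n))"
    by (simp add: coeff_R_def Let_def lessThan_nat_numeral lessThan_Suc fact_numeral)
  also have "\<dots> \<le> numer_R x"
    using x2 by (intro alternating_ge_partial_sum[OF numer_R_sums] alternating_step coeff_R_growth) auto
  finally show ?thesis .
qed

text \<open>The terms of the alternating series decrease only from the second one on when \<open>x\<close> is near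
  \<open>pi/2\<close>, so the first four are kept together as a cubic in \<open>x^2\<close>.\<close>
lemma numer_RT_neg:
  assumes "0 < x" "x < pi/2"
  shows "numer_RT x < 0"
proof -
  have x2: "x\<^sup>2 < 64/25" by (rule square_less_of_less_pi_half[OF assms])
  define y where "y = x\<^sup>2"
  have "0 < x^12 * (64/1575 - 416/17325 * y + 46168/7882875 * y^2 - 179876/212837625 * y^3)"
  proof (intro mult_pos_pos)
    have y: "0 \<le> y" "y < 64/25" using x2 by (auto simp: y_def)
    \<comment> \<open>Synthetic division of the cubic by \<open>64/25 - y\<close> gives the quotient
      \<open>b - a * y + 179876/212837625 * y^2\<close> and the remainder
      \<open>64/1575 - 64/25 * b\<close>, its value at \<open>64/25\<close>. Both are
      positive.\<close>
    define a where "a = (46168/7882875 - 64/25 * (179876/212837625) :: real)"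
    define b where "b = 416/17325 - 64/25 * a"
    have "0 < (64/25 - y) * (b - a * y + 179876/212837625 * y^2)"
    proof (intro mult_pos_pos add_pos_nonneg)
      have "a * y \<le> a * (64/25)" using y by (intro mult_left_mono) (auto simp: a_def)
      also have "\<dots> < b" by (simp add: b_def a_def)
      finally show "0 < b - a * y" by simp
    qed (use y in auto)
    hence "0 < 64/25 * b - 416/17325 * y + 46168/7882875 * y^2 - 179876/212837625 * y^3"
      unfolding b_def a_def by (simp add: power2_eq_square power3_eq_cube field_simps)
    moreover have "64/25 * b < 64/1575" by (simp add: b_def a_def)
    ultimately show "0 < 64/1575 - 416/17325 * y + 46168/7882875 * y^2 - 179876/212837625 * y^3"
      by linarith
  qed (use assms in auto)
  also have "\<dots> = 64/1575 * x^12 - 416/17325 * x^14 + 46168/7882875 * x^16 - 179876/212837625 * x^18"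
    by (simp add: y_def algebra_simps flip: power_add power_mult)
  also have "\<dots> = (\<Sum>n<10. (-1)^n * x^(2*n) / fact (2*n) * ((-1)^10 * coeff_RT n))"
    by (simp add: coeff_RT_def Let_def lessThan_nat_numeral lessThan_Suc fact_numeral)
  also have "\<dots> \<le> - numer_RT x"
    using x2 by (intro alternating_ge_partial_sum[OF numer_RT_sums] alternating_step coeff_RT_growth) auto
  finally show ?thesis by simp
qed

section \<open>The comparison functions\<close>

lemma MVT_at_right:
  fixes f f' :: "real \<Rightarrow> real"
  assumes "a < b" and lim: "(f \<longlongrightarrow> l) (at_right a)"
    and der: "\<And>x. a < x \<Longrightarrow> x \<le> b \<Longrightarrow> (f has_real_derivative f' x) (at x)"
  obtains \<xi> where "a < \<xi>" "\<xi> < b" "f b - l = (b - a) * f' \<xi>"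
proof -
  \<comment> \<open>In the applications \<open>f\<close> contains \<open>sin x / x\<close>, a
    division by zero at 0; the limit \<open>l\<close> replaces the value obtained there.\<close>
  define g where "g = f(a := l)"
  have g_der: "(g has_real_derivative f' x) (at x)" if "a < x" "x \<le> b" for x
  proof (rule has_field_derivative_transform_within_open[OF der[OF that], of "{a<..}"])
    show "f y = g y" if "y \<in> {a<..}" for y using that by (simp add: g_def)
  qed (use that in auto)
  have "continuous_on {a..b} g"
    unfolding continuous_on_eq_continuous_within
  proof
    fix x assume x: "x \<in> {a..b}"
    show "continuous (at x within {a..b}) g"
    proof (cases "x = a")
      case True
      have "(g \<longlongrightarrow> l) (at_right a)"
        using lim by (rule Lim_transform_eventually) (auto simp: g_def eventually_at_filter)
      hence "(g \<longlongrightarrow> g a) (at a within {a..b})"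
        using \<open>a < b\<close> by (simp add: at_within_Icc_at_right g_def)
      thus ?thesis by (simp add: True continuous_within)
    next
      case False
      thus ?thesis using g_der[of x] x by (auto intro: continuous_at_imp_continuous_at_within DERIV_isCont)
    qed
  qed
  moreover have "g differentiable (at x)" if "a < x" "x < b" for x
    using g_der[of x] that real_differentiable_def by auto
  ultimately obtain m z where z: "a < z" "z < b" "(g has_real_derivative m) (at z)" "g b - g a = (b - a) * m"
    using MVT[OF \<open>a < b\<close>, of g] by blast
  moreover have "m = f' z" using DERIV_unique[OF z(3) g_der] z by simp
  ultimately show thesis using that[of z] \<open>a < b\<close> by (simp add: g_def)
qed

lemma MVT_at_left:
  fixes f f' :: "real \<Rightarrow> real"
  assumes "a < b" and lim: "(f \<longlongrightarrow> l) (at_left b)"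
    and der: "\<And>x. a \<le> x \<Longrightarrow> x < b \<Longrightarrow> (f has_real_derivative f' x) (at x)"
  obtains \<xi> where "a < \<xi>" "\<xi> < b" "l - f a = (b - a) * f' \<xi>"
proof -
  have "((\<lambda>x. f (- x)) \<longlongrightarrow> l) (at_right (- b))"
    using lim by (simp add: at_left_minus[of b] filterlim_filtermap)
  moreover have "((\<lambda>x. f (- x)) has_real_derivative - f' (- x)) (at x)" if "- b < x" "x \<le> - a" for x
    using DERIV_chain'[OF DERIV_minus[OF DERIV_ident] der[of "- x"]] that by simp
  ultimately obtain \<xi> where "- b < \<xi>" "\<xi> < - a" "f (- (- a)) - l = (- a - (- b)) * (- f' (- \<xi>))"
    using MVT_at_right[of "- b" "- a" "\<lambda>x. f (- x)" l "\<lambda>x. - f' (- x)"] \<open>a < b\<close> by auto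
  thus thesis using that[of "- \<xi>"] by (simp add: algebra_simps)
qed

section \<open>Auxiliary functions and their derivatives\<close>

definition sin_gap :: "real \<Rightarrow> real" where
  "sin_gap x = sin x - x * cos x"

lemma sin_gap_deriv: "(sin_gap has_real_derivative x * sin x) (at x)"
  unfolding sin_gap_def [abs_def] by (auto intro!: derivative_eq_intros)

declare sin_gap_deriv [THEN DERIV_chain2, derivative_intros]

text \<open>The logarithmic derivative of \<open>sin x / x\<close> is
  \<open>- sin_gap x / (x * sin x)\<close>. Relative to it, \<open>ratio_T\<close> is the
  logarithmic derivative of \<open>cos x\<close>, and \<open>- ratio_R\<close> is that of
  \<open>sin_gap x / (x^2 * sin x)\<close>.\<close>

definition ratio_R :: "real \<Rightarrow> real" where
  "ratio_R x = x^2 * sin x ^ 2 / sin_gap x ^ 2 - 3 * sin x / sin_gap x + 1"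

definition ratio_T :: "real \<Rightarrow> real" where
  "ratio_T x = x * sin x ^ 2 / (cos x * sin_gap x)"

text \<open>Writing \<open>p = k * q\<close>, one has \<open>sin x / x < M k (cos x) q\<close> iff \<open>mean_gap p q x > 0\<close>. The derivative
  of \<open>mean_gap\<close> has the sign of \<open>log_ratio\<close>, whose derivative has the sign of \<open>slope\<close>.\<close>
definition slope :: "real \<Rightarrow> real \<Rightarrow> real \<Rightarrow> real" where
  "slope p q x = ratio_R x - (p - 1) + (q - 1) * ratio_T x"

definition log_ratio :: "real \<Rightarrow> real \<Rightarrow> real \<Rightarrow> real" where
  "log_ratio p q x = (p - 1) * ln (sin x / x) + ln (3 * sin_gap x / (x^2 * sin x)) - (q - 1) * ln (cos x)"

definition mean_gap :: "real \<Rightarrow> real \<Rightarrow> real \<Rightarrow> real" where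
  "mean_gap p q x = (1 - (sin x / x) powr p) / p - (1 - cos x powr q) / (3 * q)"

lemma trig_pos:
  assumes "0 < x" "x < pi/2"
  shows "0 < sin x" "0 < cos x" "0 < sin_gap x"
proof -
  show "0 < sin x" using assms by (intro sin_gt_zero) auto
  show "0 < cos x" using assms by (intro cos_gt_zero_pi) auto
  have "sin_gap 0 < sin_gap x"
  proof (rule DERIV_pos_imp_increasing_open[OF assms(1)])
    fix y assume y: "0 < y" "y < x"
    have "0 < y * sin y" using y assms by (intro mult_pos_pos sin_gt_zero) auto
    thus "\<exists>z. (sin_gap has_real_derivative z) (at y) \<and> 0 < z" using sin_gap_deriv by blast
  qed (auto simp: sin_gap_def intro!: continuous_intros)
  thus "0 < sin_gap x" by (simp add: sin_gap_def)
qed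

lemma ratio_R_deriv:
  assumes "0 < x" "x < pi/2"
  shows "(ratio_R has_real_derivative numer_R x / sin_gap x ^ 3) (at x)"
proof -
  note pos = trig_pos[OF assms]
  \<comment> \<open>With these names the comparison of numerators is polynomial modulo
    \<open>s^2 + c^2 = 1\<close>. A factor \<open>d\<close> cancels, which leaves the denominator
    \<open>d^3\<close>.\<close>
  define s c d where "s = sin x" "c = cos x" "d = sin_gap x"
  have sc: "s\<^sup>2 + c\<^sup>2 = 1" and d: "d = s - x * c" "d \<noteq> 0"
    using pos by (auto simp: s_c_d_def sin_gap_def)
  have "(ratio_R has_real_derivative ((2*x*s^2 + x^2*(2*s*c)) * d^2 - x^2*s^2*(2*d*(x*s))) / (d^2 * d^2)
           - (3*c*d - 3*s*(x*s)) / (d * d)) (at x)"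
    unfolding ratio_R_def [abs_def] s_c_d_def
    by (auto intro!: derivative_eq_intros simp: pos less_imp_neq[OF pos(3), symmetric])
       (simp add: algebra_simps power2_eq_square)?
  also have "((2*x*s^2 + x^2*(2*s*c)) * d^2 - x^2*s^2*(2*d*(x*s))) / (d^2 * d^2) - (3*c*d - 3*s*(x*s)) / (d * d)
      = (2*x*s * ((s + x*c) * d - x^2*s^2) - 3*(c*d - x*s^2) * d) / d^3"
    using d(2) by (simp add: field_simps power2_eq_square power3_eq_cube)
  also have "2*x*s * ((s + x*c) * d - x^2*s^2) - 3*(c*d - x*s^2) * d = numer_R x"
    unfolding numer_R_def s_c_d_def(1,2)[symmetric] d(1) using sc by algebra
  finally show ?thesis by (simp add: s_c_d_def)
qed

lemma ratio_T_deriv: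
  assumes "0 < x" "x < pi/2"
  shows "(ratio_T has_real_derivative sin x * (sin x ^ 2 * cos x + x * sin x - 2 * x^2 * cos x)
            / (cos x ^ 2 * sin_gap x ^ 2)) (at x)"
proof -
  note pos = trig_pos[OF assms]
  define s c d where "s = sin x" "c = cos x" "d = sin_gap x"
  have sc: "s\<^sup>2 + c\<^sup>2 = 1" and d: "d = s - x * c" "d \<noteq> 0" "c \<noteq> 0"
    using pos by (auto simp: s_c_d_def sin_gap_def)
  have "(ratio_T has_real_derivative ((s^2 + x*(2*s*c)) * (c * d) - x*s^2*(c * (x * s) - s * d)) / ((c * d) * (c * d))) (at x)"
    unfolding ratio_T_def [abs_def] s_c_d_def
    by (auto intro!: derivative_eq_intros simp: pos less_imp_neq[OF pos(3), symmetric] less_imp_neq[OF pos(2), symmetric])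
       (simp add: algebra_simps power2_eq_square)?
  also have "(s^2 + x*(2*s*c)) * (c * d) - x*s^2*(c * (x * s) - s * d) = s * (s^2 * c + x * s - 2 * x^2 * c)"
    unfolding d(1) using sc by algebra
  also have "(c * d) * (c * d) = c^2 * d^2"
    by (simp add: power2_eq_square)
  finally show ?thesis by (simp add: s_c_d_def)
qed

lemma ratio_RT_deriv:
  assumes "0 < x" "x < pi/2"
  shows "((\<lambda>x. ratio_R x - ratio_T x / 35) has_real_derivative numer_RT x / (35 * cos x ^ 2 * sin_gap x ^ 3)) (at x)"
proof -
  note pos = trig_pos[OF assms]
  define s c d where "s = sin x" "c = cos x" "d = sin_gap x"
  have sc: "s\<^sup>2 + c\<^sup>2 = 1" and d: "d = s - x * c" "d \<noteq> 0" "c \<noteq> 0"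
    using pos by (auto simp: s_c_d_def sin_gap_def)
  have "((\<lambda>x. ratio_R x - ratio_T x / 35) has_real_derivative numer_R x / d^3 -
      s * (s^2 * c + x * s - 2 * x^2 * c) / (c^2 * d^2) / 35) (at x)"
    unfolding s_c_d_def by (intro DERIV_diff DERIV_cdivide ratio_R_deriv ratio_T_deriv assms)
  also have "numer_R x / d^3 - s * (s^2 * c + x * s - 2 * x^2 * c) / (c^2 * d^2) / 35
     = (35 * c^2 * numer_R x - s * d * (s^2 * c + x * s - 2 * x^2 * c)) / (35 * c^2 * d^3)"
    using d by (simp add: field_simps power2_eq_square power3_eq_cube)
  also have "35 * c^2 * numer_R x - s * d * (s^2 * c + x * s - 2 * x^2 * c) = numer_RT x"
    unfolding numer_R_def numer_RT_def s_c_d_def(1,2)[symmetric] d(1) by algebra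
  finally show ?thesis by (simp add: s_c_d_def)
qed

lemma log_ratio_deriv:
  assumes "0 < x" "x < pi/2"
  shows "(log_ratio p q has_real_derivative sin_gap x / (x * sin x) * slope p q x) (at x)"
proof -
  note pos = trig_pos[OF assms]
  define s c d where "s = sin x" "c = cos x" "d = sin_gap x"
  have sc: "s\<^sup>2 + c\<^sup>2 = 1" and d: "d = s - x * c" and pos': "0 < s" "0 < c" "0 < d"
    using pos by (auto simp: s_c_d_def sin_gap_def)
  have "(log_ratio p q has_real_derivative (p - 1) * ((c * x - s) / (x * x) / (s / x))
     + (3 * (x * s) * (x^2 * s) - 3 * d * (2 * x * s + x^2 * c)) / ((x^2 * s) * (x^2 * s)) / (3 * d / (x^2 * s))
     - (q - 1) * (- s / c)) (at x)"
    unfolding log_ratio_def [abs_def] s_c_d_def using pos assms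
    by (auto intro!: derivative_eq_intros simp: field_simps)
  also have "(p - 1) * ((c * x - s) / (x * x) / (s / x)) = (p - 1) * (- d / (x * s))"
    using pos' assms unfolding d by (simp add: field_simps)
  also have "(3 * (x * s) * (x^2 * s) - 3 * d * (2 * x * s + x^2 * c)) / ((x^2 * s) * (x^2 * s)) / (3 * d / (x^2 * s))
      = d / (x * s) * ((x^2 * s^2 - (2 * s + x * c) * d) / d^2)"
    using pos' assms by (simp add: field_simps power2_eq_square)
  also have "(x^2 * s^2 - (2 * s + x * c) * d) / d^2 = ratio_R x"
  proof -
    have "2 * s + x * c = 3 * s - d" by (simp add: d)
    moreover have "(x^2 * s^2 - (3 * s - d) * d) / d^2 = x^2 * s^2 / d^2 - 3 * s / d + 1"
      using pos'(3) by (simp add: field_simps power2_eq_square)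
    ultimately show ?thesis
      unfolding ratio_R_def s_c_d_def[symmetric] by (simp only:)
  qed
  also have "- s / c = - (d / (x * s) * ratio_T x)"
    unfolding ratio_T_def s_c_d_def[symmetric] using pos' assms by (simp add: field_simps power2_eq_square)
  finally show ?thesis
    unfolding slope_def s_c_d_def[symmetric] by (simp add: algebra_simps add_divide_distrib diff_divide_distrib)
qed

lemma mean_gap_deriv:
  assumes "0 < x" "x < pi/2" "p \<noteq> 0" "q \<noteq> 0"
  shows "(mean_gap p q has_real_derivative cos x powr (q - 1) * sin x / 3 * (exp (log_ratio p q x) - 1)) (at x)"
proof -
  note pos = trig_pos[OF assms(1,2)]
  have "((\<lambda>x. (sin x / x) powr p) has_real_derivative
          p * (sin x / x) powr (p - 1) * ((cos x * x - sin x) / (x * x))) (at x)"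
    using pos assms by (auto intro!: derivative_eq_intros has_real_derivative_powr[THEN DERIV_chain2])
  moreover have "((\<lambda>x. cos x powr q) has_real_derivative q * cos x powr (q - 1) * (- sin x)) (at x)"
    using pos assms by (auto intro!: derivative_eq_intros has_real_derivative_powr[THEN DERIV_chain2])
  ultimately have "(mean_gap p q has_real_derivative
      (0 - p * (sin x / x) powr (p - 1) * ((cos x * x - sin x) / (x * x))) / p
        - (0 - q * cos x powr (q - 1) * (- sin x)) / (3 * q)) (at x)"
    unfolding mean_gap_def [abs_def] by (intro DERIV_diff DERIV_cdivide DERIV_const)
  also have "(0 - p * (sin x / x) powr (p - 1) * ((cos x * x - sin x) / (x * x))) / p
        - (0 - q * cos x powr (q - 1) * (- sin x)) / (3 * q)
      = (sin x / x) powr (p - 1) * sin_gap x / x^2 - cos x powr (q - 1) * sin x / 3"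
    using assms by (simp add: sin_gap_def field_simps power2_eq_square)
  \<comment> \<open>The derivative is a difference of two positive terms, and
    \<open>exp (log_ratio p q x)\<close> is their quotient. The 3 in \<open>log_ratio\<close> makes
    this quotient tend to 1 at 0.\<close>
  also have "\<dots> = cos x powr (q - 1) * sin x / 3 * (exp (log_ratio p q x) - 1)"
  proof -
    have "exp (log_ratio p q x) = (sin x / x) powr (p - 1) * (3 * sin_gap x / (x^2 * sin x)) / cos x powr (q - 1)"
      using pos assms by (simp add: log_ratio_def exp_add exp_diff powr_def)
    thus ?thesis using pos assms by (simp add: field_simps)
  qed
  finally show ?thesis .
qed

section \<open>Limits at the ends of the interval\<close>

lemma ratio_R_lim: "(ratio_R \<longlongrightarrow> 2/5) (at_right 0)"
proof -
  \<comment> \<open>The first two terms of \<open>ratio_R\<close> both grow like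
    \<open>9 / x^2\<close> and cancel to leading order, so they are combined first and then split
    into quotients with finite limits.\<close>
  have A: "((\<lambda>x::real. sin x / x) \<longlongrightarrow> 1) (at_right 0)" by real_asymp
  have B: "((\<lambda>x::real. (sin x - x * cos x) / x^3) \<longlongrightarrow> 1/3) (at_right 0)" by real_asymp
  have C: "((\<lambda>x::real. (x^2 * sin x - 3 * sin x + 3 * x * cos x) / x^5) \<longlongrightarrow> -1/15) (at_right 0)" by real_asymp
  have "((\<lambda>x::real. 1 + (x^2 * sin x - 3 * sin x + 3 * x * cos x) / x^5 * (sin x / x) / ((sin x - x * cos x) / x^3)^2)
     \<longlongrightarrow> 1 + (-1/15) * 1 / (1/3)^2) (at_right 0)"
    by (rule tendsto_add[OF tendsto_const tendsto_divide[OF tendsto_mult[OF C A] tendsto_power[OF B]]]) simp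
  moreover have "eventually (\<lambda>x. 1 + (x^2 * sin x - 3 * sin x + 3 * x * cos x) / x^5 * (sin x / x) / ((sin x - x * cos x) / x^3)^2 = ratio_R x) (at_right 0)"
    using eventually_at_right_real[OF pi_half_gt_zero]
  proof eventually_elim
    case (elim x)
    define d where "d = sin_gap x"
    have "d > 0" "x > 0" using trig_pos[of x] elim by (auto simp: d_def)
    hence "1 + (x^2 * sin x - 3 * d) / x^5 * (sin x / x) / (d / x^3)^2 = x^2 * sin x ^ 2 / d^2 - 3 * sin x / d + 1"
      by (simp add: field_simps eval_nat_numeral)
    thus ?case unfolding ratio_R_def d_def[symmetric] by (simp add: d_def sin_gap_def algebra_simps)
  qed
  ultimately show ?thesis
    by (simp add: power2_eq_square tendsto_cong)
qed

lemma ratio_T_lim: "(ratio_T \<longlongrightarrow> 3) (at_right 0)"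
  unfolding ratio_T_def [abs_def] sin_gap_def by real_asymp

lemma slope_lim: "(slope p q \<longlongrightarrow> 3 * q - p - 8/5) (at_right 0)"
proof -
  have "((\<lambda>x. ratio_R x - (p - 1) + (q - 1) * ratio_T x) \<longlongrightarrow> 2/5 - (p - 1) + (q - 1) * 3) (at_right 0)"
    by (intro tendsto_intros ratio_R_lim ratio_T_lim)
  thus ?thesis by (simp add: slope_def [abs_def] algebra_simps)
qed

lemma log_ratio_lim: "(log_ratio p q \<longlongrightarrow> 0) (at_right 0)"
proof -
  have "((\<lambda>x. sin x / x) \<longlongrightarrow> 1) (at_right (0::real))"
    by real_asymp
  moreover have "((\<lambda>x. 3 * sin_gap x / (x^2 * sin x)) \<longlongrightarrow> 1) (at_right (0::real))"
    unfolding sin_gap_def by real_asymp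
  moreover have "(cos \<longlongrightarrow> 1) (at_right (0::real))"
    by real_asymp
  ultimately have "(log_ratio p q \<longlongrightarrow> (p - 1) * ln 1 + ln 1 - (q - 1) * ln 1) (at_right 0)"
    unfolding log_ratio_def [abs_def] by (intro tendsto_intros) auto
  thus ?thesis by simp
qed

lemma mean_gap_lim_0: "(mean_gap p q \<longlongrightarrow> 0) (at_right 0)"
proof -
  have "((\<lambda>x. sin x / x) \<longlongrightarrow> 1) (at_right (0::real))"
    by real_asymp
  moreover have "(cos \<longlongrightarrow> 1) (at_right (0::real))"
    by real_asymp
  \<comment> \<open>Here \<open>p\<close> and \<open>q\<close> may be 0; multiplying by the
    constants \<open>inverse p\<close> and \<open>inverse (3 * q)\<close> is continuous even
    then.\<close>
  ultimately have "((\<lambda>x. (1 - (sin x / x) powr p) * inverse p - (1 - cos x powr q) * inverse (3 * q))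
      \<longlongrightarrow> (1 - 1 powr p) * inverse p - (1 - 1 powr q) * inverse (3 * q)) (at_right 0)"
    by (intro tendsto_intros) auto
  thus ?thesis unfolding mean_gap_def [abs_def] divide_inverse by simp
qed

lemma cos_powr_lim: "0 < q \<Longrightarrow> ((\<lambda>x. cos x powr q) \<longlongrightarrow> 0) (at_left (pi/2))"
proof -
  assume "0 < q"
  have "(cos \<longlongrightarrow> cos (pi/2)) (at_left (pi/2 :: real))"
    by (intro tendsto_intros)
  moreover have "eventually (\<lambda>x::real. 0 \<le> cos x) (at_left (pi/2))"
    using eventually_at_left_real[of 0 "pi/2"]
    by (rule eventually_mono[OF _]) (auto intro: cos_ge_zero)
  ultimately have "((\<lambda>x. cos x powr q) \<longlongrightarrow> cos (pi/2) powr q) (at_left (pi/2 :: real))"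
    using \<open>0 < q\<close> by (intro tendsto_powr') auto
  thus ?thesis by simp
qed

lemma sinc_lim: "((\<lambda>x. sin x / x) \<longlongrightarrow> 2 / pi) (at_left (pi/2))"
proof -
  have "((\<lambda>x. sin x / x) \<longlongrightarrow> sin (pi/2) / (pi/2)) (at_left (pi/2 :: real))"
    by (intro tendsto_intros) auto
  thus ?thesis by simp
qed

lemma mean_gap_lim_pi_half:
  assumes "0 < q"
  shows "(mean_gap p q \<longlongrightarrow> (1 - (2/pi) powr p) / p - 1 / (3 * q)) (at_left (pi/2))"
proof -
  have "((\<lambda>x. (1 - (sin x / x) powr p) * inverse p - (1 - cos x powr q) * inverse (3 * q))
      \<longlongrightarrow> (1 - (2/pi) powr p) * inverse p - (1 - 0) * inverse (3 * q)) (at_left (pi/2))"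
    by (intro tendsto_diff tendsto_mult_right tendsto_const cos_powr_lim[OF assms]
          tendsto_powr[OF sinc_lim tendsto_const]) simp
  thus ?thesis unfolding mean_gap_def [abs_def] divide_inverse by simp
qed

section \<open>The sign of the mean gap\<close>

lemma ratio_R_less:
  assumes "0 < x" "x < y" "y < pi/2"
  shows "ratio_R x < ratio_R y"
proof (rule DERIV_pos_imp_increasing[OF assms(2)])
  fix z assume "x \<le> z" "z \<le> y"
  hence z: "0 < z" "z < pi/2" using assms by auto
  show "\<exists>d. (ratio_R has_real_derivative d) (at z) \<and> 0 < d"
    using ratio_R_deriv[OF z] divide_pos_pos[OF numer_R_pos[OF z] zero_less_power[OF trig_pos(3)[OF z]]] by blast
qed

lemma ratio_RT_less:
  assumes "0 < x" "x < y" "y < pi/2"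
  shows "ratio_R y - ratio_T y / 35 < ratio_R x - ratio_T x / 35"
proof (rule DERIV_neg_imp_decreasing[OF assms(2)])
  fix z assume "x \<le> z" "z \<le> y"
  hence z: "0 < z" "z < pi/2" using assms by auto
  show "\<exists>d. ((\<lambda>x. ratio_R x - ratio_T x / 35) has_real_derivative d) (at z) \<and> d < 0"
  proof (intro exI conjI)
    show "numer_RT z / (35 * cos z ^ 2 * sin_gap z ^ 3) < 0"
      using numer_RT_neg[OF z] trig_pos[OF z] by (intro divide_neg_pos) auto
  qed (rule ratio_RT_deriv[OF z])
qed

lemma ratio_T_less: "0 < x \<Longrightarrow> x < y \<Longrightarrow> y < pi/2 \<Longrightarrow> ratio_T x < ratio_T y"
  using ratio_R_less[of x y] ratio_RT_less[of x y] by simp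

lemma slope_less:
  assumes "1 \<le> q" "0 < x" "x < y" "y < pi/2"
  shows "slope p q x < slope p q y"
proof -
  have "(q - 1) * ratio_T x \<le> (q - 1) * ratio_T y"
    using ratio_T_less[OF assms(2-)] assms(1) by (intro mult_left_mono) auto
  with ratio_R_less[OF assms(2-)] show ?thesis by (simp add: slope_def)
qed

text \<open>Splitting \<open>q - 1\<close> as \<open>(q - 34/35) - 1/35\<close> writes the slope, up
  to a constant, as the decreasing \<open>ratio_R - ratio_T / 35\<close> plus a nonpositive multiple
  of the increasing \<open>ratio_T\<close>.\<close>

lemma slope_greater:
  assumes "q \<le> 34/35" "0 < x" "x < y" "y < pi/2"
  shows "slope p q y < slope p q x"
proof -
  have "(34/35 - q) * ratio_T x \<le> (34/35 - q) * ratio_T y"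
    using ratio_T_less[OF assms(2-)] assms(1) by (intro mult_left_mono) auto
  with ratio_RT_less[OF assms(2-)] show ?thesis by (simp add: slope_def algebra_simps)
qed

text \<open>The relation between \<open>p\<close> and \<open>q\<close> makes the slope tend to 0 at
  0, and monotonicity moves it away from there. The factor \<sigma>, 1 or -1 in the applications,
  covers both signs.\<close>

lemma sign_slope_of_mono:
  assumes mono: "\<And>x y. 0 < x \<Longrightarrow> x < y \<Longrightarrow> y < pi/2 \<Longrightarrow> \<sigma> * slope p q x < \<sigma> * slope p q y"
    and "3 * q - p = 8/5" "0 < x" "x < pi/2"
  shows "0 < \<sigma> * slope p q x"
proof -
  have "((\<lambda>x. \<sigma> * slope p q x) \<longlongrightarrow> \<sigma> * (3 * q - p - 8/5)) (at_right 0)"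
    by (intro tendsto_mult_left slope_lim)
  hence lim: "((\<lambda>x. \<sigma> * slope p q x) \<longlongrightarrow> 0) (at_right 0)"
    using assms(2) by simp
  \<comment> \<open>The limit yields only a weak inequality, so it is taken at \<open>x/2\<close>;
    strictness comes from the step to \<open>x\<close>.\<close>
  have "0 \<le> \<sigma> * slope p q (x/2)"
  proof (rule tendsto_upperbound[OF lim])
    have "eventually (\<lambda>y. y \<in> {0<..<x/2}) (at_right 0)"
      using assms(3) by (intro eventually_at_right_real) auto
    thus "eventually (\<lambda>y. \<sigma> * slope p q y \<le> \<sigma> * slope p q (x/2)) (at_right 0)"
      by eventually_elim (use mono assms in \<open>auto intro!: less_imp_le\<close>)
  qed simp
  also have "\<dots> < \<sigma> * slope p q x" using assms(3,4) by (intro mono) auto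
  finally show ?thesis .
qed

lemma sign_pos_mult:
  assumes "(0::real) < a"
  shows "0 < \<sigma> * (a * w) \<longleftrightarrow> 0 < \<sigma> * w" "0 \<le> \<sigma> * (a * w) \<longleftrightarrow> 0 \<le> \<sigma> * w"
proof -
  have "\<sigma> * (a * w) = a * (\<sigma> * w)" by simp
  thus "0 < \<sigma> * (a * w) \<longleftrightarrow> 0 < \<sigma> * w" "0 \<le> \<sigma> * (a * w) \<longleftrightarrow> 0 \<le> \<sigma> * w"
    using mult_less_cancel_left_pos[OF assms, of 0 "\<sigma> * w"] mult_le_cancel_left_pos[OF assms, of 0 "\<sigma> * w"]
    by (simp_all only: mult_zero_right)
qed

lemma sign_times_exp_minus_one:
  assumes "(0::real) < a"
  shows "0 < \<sigma> * (a * (exp w - 1)) \<longleftrightarrow> 0 < \<sigma> * w"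
    and "0 \<le> \<sigma> * (a * (exp w - 1)) \<longleftrightarrow> 0 \<le> \<sigma> * w"
  unfolding sign_pos_mult[OF assms] by (simp_all add: zero_less_mult_iff zero_le_mult_iff)

lemma log_ratio_factor_pos: "0 < x \<Longrightarrow> x < pi/2 \<Longrightarrow> 0 < sin_gap x / (x * sin x)"
  using trig_pos[of x] by simp

lemma mean_gap_factor_pos: "0 < x \<Longrightarrow> x < pi/2 \<Longrightarrow> 0 < cos x powr (q - 1) * sin x / 3"
  using trig_pos[of x] by simp

text \<open>\<open>mean_gap\<close> and \<open>log_ratio\<close> both tend to 0 at 0, so two uses of
  the mean value theorem carry the sign of the slope over to the gap. Only points below
  \<open>x\<close> enter, so this also serves near 0.\<close>

lemma sign_mean_gap_of_sign_slope:
  assumes pq: "p \<noteq> 0" "q \<noteq> 0" and x: "0 < x" "x < pi/2"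
    and sgn: "\<And>y. 0 < y \<Longrightarrow> y < x \<Longrightarrow> 0 < \<sigma> * slope p q y"
  shows "0 < \<sigma> * mean_gap p q x"
proof -
  obtain \<xi> where \<xi>: "0 < \<xi>" "\<xi> < x" "mean_gap p q x - 0 = (x - 0) * (cos \<xi> powr (q - 1) * sin \<xi> / 3 * (exp (log_ratio p q \<xi>) - 1))"
    by (rule MVT_at_right[OF x(1) mean_gap_lim_0[of p q] mean_gap_deriv[of _ p q]]) (use x pq in auto)
  obtain \<eta> where \<eta>: "0 < \<eta>" "\<eta> < \<xi>" "log_ratio p q \<xi> - 0 = (\<xi> - 0) * (sin_gap \<eta> / (\<eta> * sin \<eta>) * slope p q \<eta>)"
    by (rule MVT_at_right[OF \<xi>(1) log_ratio_lim[of p q] log_ratio_deriv[of _ p q]]) (use \<xi> x in auto)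
  have pre: "0 < sin_gap \<eta> / (\<eta> * sin \<eta>)" "0 < cos \<xi> powr (q - 1) * sin \<xi> / 3"
    by (rule log_ratio_factor_pos mean_gap_factor_pos; use \<eta> \<xi> x in force)+
  have "0 < \<sigma> * (\<xi> * (sin_gap \<eta> / (\<eta> * sin \<eta>) * slope p q \<eta>))"
    unfolding sign_pos_mult[OF \<xi>(1)] sign_pos_mult[OF pre(1)] using \<eta> \<xi> by (intro sgn) auto
  hence "0 < \<sigma> * log_ratio p q \<xi>"
    using \<eta>(3) by simp
  hence "0 < \<sigma> * (x * (cos \<xi> powr (q - 1) * sin \<xi> / 3 * (exp (log_ratio p q \<xi>) - 1)))"
    unfolding sign_pos_mult[OF x(1)] sign_times_exp_minus_one[OF pre(2)] .
  thus ?thesis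
    using \<xi>(3) by (simp only: diff_0_right)
qed

text \<open>If the gap vanishes at both ends and had the wrong sign at \<open>x\<close>, the mean value theorem used on
  both sides of \<open>x\<close> and then for \<open>log_ratio\<close> would give two points where the signs of the slope
  contradict its monotonicity. The factor \<open>\<sigma>\<close> is 1 or -1 in the applications.\<close>
lemma sign_mean_gap_of_anti_slope:
  assumes pq: "p \<noteq> 0" "0 < q" and x: "0 < x" "x < pi/2"
    and end0: "(1 - (2/pi) powr p) / p = 1 / (3 * q)"
    and sgn: "\<And>x y. 0 < x \<Longrightarrow> x < y \<Longrightarrow> y < pi/2 \<Longrightarrow> \<sigma> * slope p q y < \<sigma> * slope p q x"
  shows "0 < \<sigma> * mean_gap p q x"
proof (rule ccontr)
  let ?dG = "\<lambda>x. cos x powr (q - 1) * sin x / 3 * (exp (log_ratio p q x) - 1)"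
  let ?dLR = "\<lambda>x. sin_gap x / (x * sin x) * slope p q x"
  assume "\<not> 0 < \<sigma> * mean_gap p q x"
  hence neg: "0 \<le> - \<sigma> * mean_gap p q x" by simp
  have lim: "(mean_gap p q \<longlongrightarrow> 0) (at_left (pi/2))"
    using mean_gap_lim_pi_half[OF pq(2), of p] end0 by simp
  obtain \<xi> where \<xi>: "0 < \<xi>" "\<xi> < x" "mean_gap p q x - 0 = (x - 0) * ?dG \<xi>"
    by (rule MVT_at_right[OF x(1) mean_gap_lim_0[of p q] mean_gap_deriv[of _ p q]]) (use x pq in auto)
  obtain \<zeta> where \<zeta>: "x < \<zeta>" "\<zeta> < pi/2" "0 - mean_gap p q x = (pi/2 - x) * ?dG \<zeta>"
    by (rule MVT_at_left[OF x(2) lim mean_gap_deriv[of _ p q]]) (use x pq in auto)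
  have gt: "0 < x - 0" "0 < pi/2 - x" using x by auto
  have pre: "0 < cos \<xi> powr (q - 1) * sin \<xi> / 3" "0 < cos \<zeta> powr (q - 1) * sin \<zeta> / 3"
    by (rule mean_gap_factor_pos; use \<xi> \<zeta> x in force)+
  have "0 \<le> - \<sigma> * ((x - 0) * ?dG \<xi>)"
    using neg unfolding \<xi>(3)[symmetric] by simp
  hence w\<xi>: "0 \<le> - \<sigma> * log_ratio p q \<xi>"
    unfolding sign_pos_mult[OF gt(1)] sign_times_exp_minus_one[OF pre(1)] .
  have "0 \<le> \<sigma> * ((pi/2 - x) * ?dG \<zeta>)"
    using neg unfolding \<zeta>(3)[symmetric] by simp
  hence w\<zeta>: "0 \<le> \<sigma> * log_ratio p q \<zeta>"
    unfolding sign_pos_mult[OF gt(2)] sign_times_exp_minus_one[OF pre(2)] .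
  obtain \<eta> where \<eta>: "0 < \<eta>" "\<eta> < \<xi>" "log_ratio p q \<xi> - 0 = (\<xi> - 0) * ?dLR \<eta>"
    by (rule MVT_at_right[OF \<xi>(1) log_ratio_lim[of p q] log_ratio_deriv[of _ p q]]) (use \<xi> x in auto)
  have "\<xi> < \<zeta>" using \<xi> \<zeta> by simp
  then obtain \<theta> where \<theta>: "\<xi> < \<theta>" "\<theta> < \<zeta>" "log_ratio p q \<zeta> - log_ratio p q \<xi> = (\<zeta> - \<xi>) * ?dLR \<theta>"
    using MVT2[of \<xi> \<zeta> "log_ratio p q" ?dLR] log_ratio_deriv \<xi> \<zeta> by force
  have pre': "0 < sin_gap \<eta> / (\<eta> * sin \<eta>)" "0 < sin_gap \<theta> / (\<theta> * sin \<theta>)"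
    by (rule log_ratio_factor_pos; use \<xi> \<zeta> \<eta> \<theta> x in force)+
  have "0 \<le> - \<sigma> * (\<xi> * ?dLR \<eta>)" using w\<xi> \<eta>(3) by simp
  hence "0 \<le> - \<sigma> * slope p q \<eta>"
    unfolding sign_pos_mult[OF \<xi>(1)] sign_pos_mult[OF pre'(1)] .
  moreover have "0 \<le> \<sigma> * (log_ratio p q \<zeta> - log_ratio p q \<xi>)"
    using w\<xi> w\<zeta> by (simp add: right_diff_distrib)
  hence "0 \<le> \<sigma> * ((\<zeta> - \<xi>) * ?dLR \<theta>)" unfolding \<theta>(3) .
  moreover have "0 < \<zeta> - \<xi>" using \<open>\<xi> < \<zeta>\<close> by simp
  ultimately have "0 \<le> - \<sigma> * slope p q \<eta>" "0 \<le> \<sigma> * slope p q \<theta>"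
    by (simp_all only: sign_pos_mult[OF pre'(2)] sign_pos_mult[of "\<zeta> - \<xi>"])
  moreover have "\<sigma> * slope p q \<theta> < \<sigma> * slope p q \<eta>"
    using \<eta> \<theta> \<zeta> by (intro sgn) auto
  ultimately show False by simp
qed

text \<open>The nonzero limit of the slope fixes its sign on some interval to the right of 0, and
  with it the sign of the gap.\<close>

lemma ex_sign_mean_gap_near_0:
  assumes "p \<noteq> 0" "q \<noteq> 0" "0 < \<sigma> * (3 * q - p - 8/5)"
  obtains x where "0 < x" "x < pi/2" "0 < \<sigma> * mean_gap p q x"
proof -
  have "((\<lambda>x. \<sigma> * slope p q x) \<longlongrightarrow> \<sigma> * (3 * q - p - 8/5)) (at_right 0)"
    by (intro tendsto_mult_left slope_lim)
  hence "eventually (\<lambda>x. 0 < \<sigma> * slope p q x) (at_right 0)"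
    using assms(3) by (rule order_tendstoD)
  then obtain b where b: "b > 0" "\<And>y. 0 < y \<Longrightarrow> y < b \<Longrightarrow> 0 < \<sigma> * slope p q y"
    unfolding eventually_at_right_field by auto
  define x where "x = min b 1"
  have x: "0 < x" "x < pi/2" "x \<le> b" using b(1) pi_ge_3 by (auto simp: x_def)
  thus thesis using that[of x] sign_mean_gap_of_sign_slope[OF assms(1,2) x(1,2), of \<sigma>] b(2) by force
qed

section \<open>Power means and threshold values\<close>

lemma less_powr_inverse_iff:
  assumes "(0::real) < a" "0 < b" "0 < p"
  shows "a < b powr (1 / p) \<longleftrightarrow> a powr p < b" "b powr (1 / p) < a \<longleftrightarrow> b < a powr p"
proof -
  have "a < b powr (1 / p) \<longleftrightarrow> ln a < ln b / p" "b powr (1 / p) < a \<longleftrightarrow> ln b / p < ln a"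
    using assms ln_less_cancel_iff[of a "b powr (1 / p)"] ln_less_cancel_iff[of "b powr (1 / p)" a]
    by (simp_all add: ln_powr)
  moreover have "a powr p < b \<longleftrightarrow> p * ln a < ln b" "b < a powr p \<longleftrightarrow> ln b < p * ln a"
    using assms ln_less_cancel_iff[of "a powr p" b] ln_less_cancel_iff[of b "a powr p"]
    by (simp_all add: ln_powr)
  ultimately show "a < b powr (1 / p) \<longleftrightarrow> a powr p < b" "b powr (1 / p) < a \<longleftrightarrow> b < a powr p"
    using assms by (simp_all add: pos_less_divide_eq pos_divide_less_eq mult.commute)
qed

lemma mean_base_pos:
  fixes k :: real
  assumes "0 < k" "k < 3" "0 < u"
  shows "0 < 1 - k/3 + k/3 * u"
  using assms by (intro add_pos_pos mult_pos_pos) auto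

text \<open>Raising to the positive power \<open>k * q\<close> keeps the order, and the difference
  of the two powers is \<open>k * q\<close> times the gap.\<close>

lemma sinc_less_M_iff:
  assumes "0 < k" "k < 3" "0 < q" "0 < x" "x < pi/2"
  shows "sin x / x < M k (cos x) q \<longleftrightarrow> 0 < mean_gap (k * q) q x"
    and "M k (cos x) q < sin x / x \<longleftrightarrow> mean_gap (k * q) q x < 0"
proof -
  note pos = trig_pos[OF assms(4,5)]
  have B: "0 < 1 - k/3 + k/3 * cos x powr q"
    using pos assms by (intro mean_base_pos) auto
  have gap: "3 * (k * q) * mean_gap (k * q) q x = 3 * (1 - k/3 + k/3 * cos x powr q - (sin x / x) powr (k * q))"
    using assms by (simp add: mean_gap_def field_simps)
  have kq: "0 < 3 * (k * q)" using assms by simp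
  have "0 < mean_gap (k * q) q x \<longleftrightarrow> 0 < 3 * (k * q) * mean_gap (k * q) q x"
       "mean_gap (k * q) q x < 0 \<longleftrightarrow> 3 * (k * q) * mean_gap (k * q) q x < 0"
    using mult_less_cancel_left_pos[OF kq, of 0 "mean_gap (k * q) q x"]
      mult_less_cancel_left_pos[OF kq, of "mean_gap (k * q) q x" 0] by (simp_all only: mult_zero_right)
  thus "sin x / x < M k (cos x) q \<longleftrightarrow> 0 < mean_gap (k * q) q x"
    and "M k (cos x) q < sin x / x \<longleftrightarrow> mean_gap (k * q) q x < 0"
    unfolding gap M_def using assms pos less_powr_inverse_iff[OF _ B, of "sin x / x" "k * q"] by auto
qed

lemma weighted_AM_GM:
  fixes w s :: real
  assumes "0 < w" "w < 1" "0 < s"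
  shows "s powr w \<le> 1 - w + w * s"
  using Youngs_inequality_0[of w "1 - w" s 1] assms by simp

lemma powr_weighted_mean_le:
  fixes w u r :: real
  assumes "0 < w" "w < 1" "0 < u" "1 < r"
  shows "(1 - w + w * u) powr r \<le> 1 - w + w * u powr r"
  using convex_onD[OF powr_convex[of r], of w 1 u] assms by simp

text \<open>Between positive orders this is convexity of a power. Negative orders are compared
  through the geometric mean \<open>t powr (1/3)\<close>, the value at order 0, by the weighted
  AM-GM inequality.\<close>

lemma M_mono:
  assumes k: "0 < k" "k < 3" and "0 < t" "q \<le> q'" "0 < q'"
  shows "M k t q \<le> M k t q'"
proof -
  have geo: "t powr (1/3) \<le> M k t q'" 
  proof -
    have "(t powr q') powr (k/3) \<le> 1 - k/3 + k/3 * t powr q'"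
      using assms by (intro weighted_AM_GM) auto
    hence "((t powr q') powr (k/3)) powr (1 / (k * q')) \<le> M k t q'"
      unfolding M_def using assms by (auto intro!: powr_mono2)
    thus ?thesis using assms by (simp add: powr_powr)
  qed
  consider "q < 0" | "q = 0" | "0 < q" "q = q'" | "0 < q" "q < q'" using assms by linarith
  thus ?thesis
  proof cases
    case 1
    have "(t powr q) powr (k/3) \<le> 1 - k/3 + k/3 * t powr q"
      using assms by (intro weighted_AM_GM) auto
    \<comment> \<open>The exponent \<open>1 / (k * q)\<close> is negative and reverses the
      inequality.\<close>
    hence "M k t q \<le> ((t powr q) powr (k/3)) powr (1 / (k * q))"
      unfolding M_def using assms 1 by (auto intro!: powr_mono2' simp: mult_le_0_iff)
    also have "\<dots> = t powr (1/3)" using assms 1 by (simp add: powr_powr)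
    finally show ?thesis using geo by simp
  next
    case 2 thus ?thesis using geo by (simp add: M_def)
  next
    case 4
    have "(1 - k/3 + k/3 * t powr q) powr (q'/q) \<le> 1 - k/3 + k/3 * (t powr q) powr (q'/q)"
      using assms 4 by (intro powr_weighted_mean_le) auto
    also have "(t powr q) powr (q'/q) = t powr q'"
      using 4 by (simp add: powr_powr)
    finally have "((1 - k/3 + k/3 * t powr q) powr (q'/q)) powr (1 / (k * q')) \<le> M k t q'"
      unfolding M_def using assms by (auto intro!: powr_mono2)
    moreover have "((1 - k/3 + k/3 * t powr q) powr (q'/q)) powr (1 / (k * q')) = M k t q"
      unfolding M_def powr_powr using assms 4 by (simp add: mult.commute)
    ultimately show ?thesis by simp
  qed simp
qed

section \<open>Strict convexity of powers and the threshold values\<close>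

lemma powr_three_chords:
  fixes b :: real
  assumes b: "0 < b" "b < 1" and "x < y" "y < z"
  shows "(b powr y - b powr x) * (z - y) < (b powr z - b powr y) * (y - x)"
proof -
  have der: "((\<lambda>p. b powr p) has_real_derivative b powr p * ln b) (at p)" for p
    using b by (auto intro!: derivative_eq_intros)
  obtain \<xi> where \<xi>: "x < \<xi>" "\<xi> < y" "b powr y - b powr x = (y - x) * (b powr \<xi> * ln b)"
    using MVT2[OF assms(3), of "\<lambda>p. b powr p" "\<lambda>p. b powr p * ln b"] der by blast
  obtain \<eta> where \<eta>: "y < \<eta>" "\<eta> < z" "b powr z - b powr y = (z - y) * (b powr \<eta> * ln b)"
    using MVT2[OF assms(4), of "\<lambda>p. b powr p" "\<lambda>p. b powr p * ln b"] der by blast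
  \<comment> \<open>The power decreases and \<open>ln b\<close> is negative, so the derivative
    increases and the right chord has the larger slope.\<close>
  have "b powr \<eta> < b powr \<xi>" using b \<xi> \<eta> by (simp add: powr_less_mono')
  hence "b powr \<xi> * ln b < b powr \<eta> * ln b" using b by simp
  hence "(y - x) * (z - y) * (b powr \<xi> * ln b) < (y - x) * (z - y) * (b powr \<eta> * ln b)"
    using assms by (intro mult_strict_left_mono) auto
  thus ?thesis unfolding \<xi>(3) \<eta>(3) by (simp only: mult_ac)
qed

text \<open>The points 0, \<open>p\<close> and \<open>p'\<close> cannot all lie on one line, by strict convexity.\<close>
lemma powr_line_unique:
  fixes b c p p' :: real
  assumes b: "0 < b" "b < 1" and "b powr p = 1 - c * p" "b powr p' = 1 - c * p'" "p \<noteq> 0" "p' \<noteq> 0"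
  shows "p = p'"
proof -
  have *: False if "x < y" "y < z" "b powr x = 1 - c * x" "b powr y = 1 - c * y" "b powr z = 1 - c * z" for x y z
    using powr_three_chords[OF b that(1,2)] unfolding that(3-5) by (simp add: algebra_simps)
  have 0: "b powr 0 = 1 - c * 0" using b by simp
  show ?thesis
    using *[OF _ _ assms(3,4) 0] *[OF _ _ assms(3) 0 assms(4)] *[OF _ _ 0 assms(3,4)]
      *[OF _ _ assms(4,3) 0] *[OF _ _ assms(4) 0 assms(3)] *[OF _ _ 0 assms(4,3)] assms(5,6)
      linorder_less_linear[of p p'] linorder_less_linear[of p 0] linorder_less_linear[of p' 0]
    by blast
qed

lemma two_over_pi: "0 < 2/pi" "2/pi < 1" "2/pi \<le> 2/3"
  using pi_ge_3 by (auto simp: field_simps)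

text \<open>The equation asks for the second point, besides (0, 1), where the convex function
  \<open>(2/pi) powr p\<close> meets the line \<open>1 - p / (3 * v)\<close>. The values 1 and 34/35
  of \<open>v\<close> give \<open>p0\<close> and \<open>p0_star\<close>.\<close>

lemma threshold_props:
  fixes v :: real
  assumes v: "34/35 \<le> v" "v \<le> 1"
  defines "P \<equiv> (THE p. p / (3 * (1 - (2/pi) powr p)) = v)"
  shows "0 < P" "(2/pi) powr P = 1 - P / (3 * v)"
proof -
  note b = two_over_pi
  define c where "c = 1 / (3 * v)"
  have c: "1/3 \<le> c" "c \<le> 35/102" using v by (auto simp: c_def field_simps)
  \<comment> \<open>At \<open>p = 0\<close> the quotient is 0/0, which has the value 0 and not
    \<open>v\<close>; this excludes the trivial intersection.\<close>
  have iff: "p / (3 * (1 - (2/pi) powr p)) = v \<longleftrightarrow> p \<noteq> 0 \<and> (2/pi) powr p = 1 - c * p" for p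
  proof (cases "p = 0")
    case False
    hence "(2/pi) powr p \<noteq> 1"
      using b powr_inj[of "2/pi" p 0] by (metis less_irrefl powr_zero_eq_one)
    thus ?thesis using False v by (simp add: c_def field_simps)
  qed (use v in auto)
  \<comment> \<open>The interval avoids the intersection at 0: the left-hand side is at most 0.82 +
    35/204 < 1 at 1/2, and it exceeds \<open>3 * c >= 1\<close> at 3.\<close>
  have "\<exists>p. 1/2 \<le> p \<and> p \<le> 3 \<and> (2/pi) powr p + c * p = 1"
  proof (rule IVT)
    have "(2/pi) powr (1/2) \<le> (2/3) powr (1/2)" using b by (intro powr_mono2) auto
    also have "\<dots> = sqrt (2/3)" by (simp add: powr_half_sqrt)
    also have "\<dots> \<le> 82/100" by (rule real_le_lsqrt) (simp_all add: power2_eq_square)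
    finally show "(2/pi) powr (1/2) + c * (1/2) \<le> 1" using c by simp
    have "0 < (2/pi) powr 3" using b by simp
    thus "1 \<le> (2/pi) powr 3 + c * 3" using c by linarith
    show "\<forall>x. 1/2 \<le> x \<and> x \<le> 3 \<longrightarrow> isCont (\<lambda>p. (2/pi) powr p + c * p) x"
      using b by (auto intro!: continuous_intros)
  qed simp
  then obtain p where p: "1/2 \<le> p" "(2/pi) powr p = 1 - c * p" by force
  have "P = p"
    unfolding P_def iff
  proof (rule the_equality)
    show "p \<noteq> 0 \<and> (2/pi) powr p = 1 - c * p" using p by auto
    show "p' = p" if "p' \<noteq> 0 \<and> (2/pi) powr p' = 1 - c * p'" for p'
      by (rule powr_line_unique[OF b(1,2), where c = c]) (use that p in auto)
  qed
  thus "0 < P" "(2/pi) powr P = 1 - P / (3 * v)" using p by (auto simp: c_def)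
qed

section \<open>The order determined by the end point pi/2\<close>

context
  fixes k q1 :: real
  assumes k: "0 < k" "k < 3"
  defines "q1 \<equiv> ln (1 - k/3) / (k * ln (2/pi))"
begin

lemma ln_two_over_pi_neg: "ln (2/pi) < 0"
  using two_over_pi by (simp add: ln_less_zero)

text \<open>After taking logarithms, the division by the negative number
  \<open>k * ln (2/pi)\<close> reverses the order. At \<open>q = q1\<close> the limit of the gap at
  pi/2 vanishes.\<close>

lemma end_order_less_iff: "q1 < q \<longleftrightarrow> (2/pi) powr (k * q) < 1 - k/3"
  and less_end_order_iff: "q < q1 \<longleftrightarrow> 1 - k/3 < (2/pi) powr (k * q)"
proof -
  have neg: "k * ln (2/pi) < 0" using k ln_two_over_pi_neg by (simp add: mult_pos_neg)
  have l: "0 < 1 - k/3" using k by simp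
  have *: "ln ((2/pi) powr (k * q)) = q * (k * ln (2/pi))"
    using two_over_pi by (simp add: ln_powr mult_ac)
  have "(2/pi) powr (k * q) < 1 - k/3 \<longleftrightarrow> q * (k * ln (2/pi)) < ln (1 - k/3)"
    using l two_over_pi unfolding *[symmetric] by (subst ln_less_cancel_iff) auto
  thus "q1 < q \<longleftrightarrow> (2/pi) powr (k * q) < 1 - k/3"
    using neg by (simp add: q1_def neg_divide_less_eq)
  have "1 - k/3 < (2/pi) powr (k * q) \<longleftrightarrow> ln (1 - k/3) < q * (k * ln (2/pi))"
    using l two_over_pi unfolding *[symmetric] by (subst ln_less_cancel_iff) auto
  thus "q < q1 \<longleftrightarrow> 1 - k/3 < (2/pi) powr (k * q)"
    using neg by (simp add: q1_def neg_less_divide_eq)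
qed

lemma end_order_pos: "0 < q1"
  using k ln_two_over_pi_neg unfolding q1_def by (intro divide_neg_neg) (auto simp: mult_pos_neg ln_less_zero)

lemma end_order_powr: "(2/pi) powr (k * q1) = 1 - k/3"
  using end_order_less_iff[of q1] less_end_order_iff[of q1] by simp

lemma end_order_eq: "(1 - (2/pi) powr (k * q1)) / (k * q1) = 1 / (3 * q1)"
  unfolding end_order_powr using k end_order_pos by simp

text \<open>Up to the positive factor \<open>1 / (k * q)\<close>, the expression on the right is
  \<sigma> times the limit of the gap at pi/2, where a strict sign survives only weakly.\<close>

lemma mean_gap_end_sign:
  assumes "0 < q" "\<And>x. 0 < x \<Longrightarrow> x < pi/2 \<Longrightarrow> 0 < \<sigma> * mean_gap (k * q) q x"
  shows "0 \<le> \<sigma> * (1 - k/3 - (2/pi) powr (k * q))"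
proof -
  have "((\<lambda>x. \<sigma> * mean_gap (k * q) q x) \<longlongrightarrow> \<sigma> * ((1 - (2/pi) powr (k * q)) / (k * q) - 1 / (3 * q))) (at_left (pi/2))"
    by (intro tendsto_mult_left mean_gap_lim_pi_half assms)
  moreover have "eventually (\<lambda>x. 0 \<le> \<sigma> * mean_gap (k * q) q x) (at_left (pi/2))"
    using eventually_at_left_real[OF pi_half_gt_zero]
    by eventually_elim (use assms(2) in \<open>auto intro!: less_imp_le\<close>)
  ultimately have "0 \<le> \<sigma> * ((1 - (2/pi) powr (k * q)) / (k * q) - 1 / (3 * q))"
    by (rule tendsto_lowerbound) simp
  also have "(1 - (2/pi) powr (k * q)) / (k * q) - 1 / (3 * q) = 1 / (k * q) * (1 - k/3 - (2/pi) powr (k * q))"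
    using k assms(1) by (simp add: field_simps)
  finally show ?thesis
    using k assms(1) by (subst (asm) sign_pos_mult) auto
qed

lemma M_less_sinc_iff_order_le_end:
  assumes "p0 < k"
  shows "(\<forall>x\<in>{0<..<pi/2}. M k (cos x) q < sin x / x) \<longleftrightarrow> q \<le> q1"
proof
  assume H: "\<forall>x\<in>{0<..<pi/2}. M k (cos x) q < sin x / x"
  show "q \<le> q1"
  proof (rule ccontr)
    assume "\<not> q \<le> q1"
    hence "q1 < q" "0 < q" using end_order_pos by auto
    have "0 \<le> (-1) * (1 - k/3 - (2/pi) powr (k * q))"
      using H sinc_less_M_iff(2)[OF k \<open>0 < q\<close>] by (intro mean_gap_end_sign \<open>0 < q\<close>) auto
    thus False using end_order_less_iff \<open>q1 < q\<close> by simp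
  qed
next
  assume "q \<le> q1"
  note P = threshold_props[of 1, folded p0_def]
  \<comment> \<open>At 0 and \<open>p0\<close> the power lies on the line \<open>1 - p/3\<close>, so
    by strict convexity it lies above that line at \<open>k > p0\<close>. This says
    \<open>1 < q1\<close>, the range where the slope increases.\<close>
  have "((2/pi) powr p0 - (2/pi) powr 0) * (k - p0) < ((2/pi) powr k - (2/pi) powr p0) * (p0 - 0)"
    using P assms by (intro powr_three_chords two_over_pi) auto
  hence "p0 * (1 - k/3) < p0 * (2/pi) powr k"
    using P by (simp add: algebra_simps diff_divide_distrib)
  hence "1 - k/3 < (2/pi) powr (k * 1)" using P by simp
  hence "1 < q1" by (simp only: less_end_order_iff)
  show "\<forall>x\<in>{0<..<pi/2}. M k (cos x) q < sin x / x"
  proof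
    fix x assume x: "x \<in> {0<..<pi/2}"
    have "0 < (-1) * mean_gap (k * q1) q1 x"
      using k end_order_pos x end_order_eq slope_less[of q1] \<open>1 < q1\<close> by (intro sign_mean_gap_of_anti_slope) auto
    hence "M k (cos x) q1 < sin x / x"
      using x sinc_less_M_iff(2)[OF k end_order_pos] by simp
    moreover have "M k (cos x) q \<le> M k (cos x) q1"
      using x trig_pos[of x] by (intro M_mono k end_order_pos \<open>q \<le> q1\<close>) auto
    ultimately show "M k (cos x) q < sin x / x" by simp
  qed
qed

lemma sinc_less_M_iff_order_ge_end:
  assumes "k < p0_star"
  shows "(\<forall>x\<in>{0<..<pi/2}. sin x / x < M k (cos x) q) \<longleftrightarrow> q1 \<le> q"
proof
  assume H: "\<forall>x\<in>{0<..<pi/2}. sin x / x < M k (cos x) q"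
  show "q1 \<le> q"
  proof (rule ccontr)
    assume "\<not> q1 \<le> q"
    \<comment> \<open>The gap criterion needs a positive order while \<open>q\<close> may be
      nonpositive; \<open>q'\<close> is a positive order below \<open>q1\<close> to which the
      inequality extends by monotonicity.\<close>
    define q' where "q' = max q (q1/2)"
    have q': "0 < q'" "q' < q1" "q \<le> q'" using \<open>\<not> q1 \<le> q\<close> end_order_pos by (auto simp: q'_def)
    have "0 < 1 * mean_gap (k * q') q' x" if x: "0 < x" "x < pi/2" for x
    proof -
      have "sin x / x < M k (cos x) q" using H x by simp
      also have "\<dots> \<le> M k (cos x) q'" using x trig_pos[of x] q' by (intro M_mono k) auto
      finally show ?thesis using sinc_less_M_iff(1)[OF k q'(1) x] by simp
    qed
    from mean_gap_end_sign[OF q'(1) this] show False using less_end_order_iff q' by simp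
  qed
next
  assume "q1 \<le> q"
  note P = threshold_props[of "34/35", folded p0_star_def]
  \<comment> \<open>Since \<open>p < k < p0_star\<close>, strict convexity puts the power below the
    line through its values at 0 and \<open>p0_star\<close>. That line has slope -35/102, so its
    value at \<open>p\<close> is \<open>1 - k/3\<close>, and \<open>q1 < 34/35\<close>
    follows.\<close>
  define p where "p = k * (34/35)"
  have p: "0 < p" "p < p0_star" using k assms by (auto simp: p_def)
  have "((2/pi) powr p - (2/pi) powr 0) * (p0_star - p) < ((2/pi) powr p0_star - (2/pi) powr p) * (p - 0)"
    using p by (intro powr_three_chords two_over_pi) auto
  hence "p0_star * (2/pi) powr p < p0_star * (1 - p * (35/102))"
    using P by (simp add: algebra_simps)
  hence "(2/pi) powr p < 1 - p * (35/102)" using P by simp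
  hence "(2/pi) powr (k * (34/35)) < 1 - k/3" by (simp add: p_def)
  hence "q1 < 34/35" by (simp only: end_order_less_iff)
  show "\<forall>x\<in>{0<..<pi/2}. sin x / x < M k (cos x) q"
  proof
    fix x assume x: "x \<in> {0<..<pi/2}"
    have "0 < 1 * mean_gap (k * q1) q1 x"
      using k end_order_pos x end_order_eq slope_greater[of q1] \<open>q1 < 34/35\<close> by (intro sign_mean_gap_of_anti_slope) auto
    hence "sin x / x < M k (cos x) q1"
      using x sinc_less_M_iff(1)[OF k end_order_pos] by simp
    moreover have "M k (cos x) q1 \<le> M k (cos x) q"
      using x trig_pos[of x] end_order_pos \<open>q1 \<le> q\<close> by (intro M_mono k) auto
    ultimately show "sin x / x < M k (cos x) q" by simp
  qed
qed

end

section \<open>The order determined by the behaviour at 0\<close>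

lemma sinc_less_M_iff_order_ge:
  fixes k q :: real
  assumes k: "0 < k" "k < 3" and "7/5 \<le> k"
  shows "(\<forall>x\<in>{0<..<pi/2}. sin x / x < M k (cos x) q) \<longleftrightarrow> 8 / (5 * (3 - k)) \<le> q"
proof -
  define r where "r = 8 / (5 * (3 - k))"
  have "u * (8 / (5 * u)) = 8/5" if "u \<noteq> 0" for u :: real using that by simp
  from this[of "3 - k"] have "(3 - k) * r = 8/5" using k by (simp add: r_def)
  hence eq: "3 * r - k * r = 8/5" by (simp add: left_diff_distrib)
  \<comment> \<open>\<open>k = 7/5\<close> is the value at which \<open>r\<close> equals 1, the
    bound needed for an increasing slope.\<close>
  have r: "1 \<le> r" "0 < r" using assms by (simp_all add: r_def field_simps)
  have "r \<le> q" if H: "\<forall>x\<in>{0<..<pi/2}. sin x / x < M k (cos x) q"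
  proof (rule ccontr)
    assume "\<not> r \<le> q"
    define q' where "q' = max q (r/2)"
    have q': "0 < q'" "q' < r" "q \<le> q'" using \<open>\<not> r \<le> q\<close> r by (auto simp: q'_def)
    \<comment> \<open>The limit of the slope at 0 is \<open>(3 - k) * (q' - r)\<close>, which is
      negative.\<close>
    have "(3 - k) * q' < (3 - k) * r" using q' k by (intro mult_strict_left_mono) auto
    hence "0 < (-1) * (3 * q' - k * q' - 8/5)" using eq by (simp add: algebra_simps)
    then obtain x where x: "0 < x" "x < pi/2" "0 < (-1) * mean_gap (k * q') q' x"
      by (rule ex_sign_mean_gap_near_0[rotated 2]) (use k q' in auto)
    have "sin x / x < M k (cos x) q" using H x by simp
    also have "\<dots> \<le> M k (cos x) q'" using x trig_pos[of x] q' by (intro M_mono k) auto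
    finally show False using sinc_less_M_iff(1)[OF k q'(1) x(1,2)] x(3) by simp
  qed
  moreover have "sin x / x < M k (cos x) q" if "r \<le> q" and x: "x \<in> {0<..<pi/2}" for x
  proof -
    have "0 < 1 * mean_gap (k * r) r x"
      using k r eq x slope_less[of r] by (intro sign_mean_gap_of_sign_slope sign_slope_of_mono) auto
    hence "sin x / x < M k (cos x) r"
      using x sinc_less_M_iff(1)[OF k r(2)] by simp
    also have "\<dots> \<le> M k (cos x) q"
      using x trig_pos[of x] r \<open>r \<le> q\<close> by (intro M_mono k) auto
    finally show ?thesis .
  qed
  ultimately show ?thesis unfolding r_def by blast
qed

lemma M_less_sinc_iff_order_le:
  fixes k q :: real
  assumes k: "0 < k" "k < 3" and "k \<le> 23/17"
  shows "(\<forall>x\<in>{0<..<pi/2}. M k (cos x) q < sin x / x) \<longleftrightarrow> q \<le> 8 / (5 * (3 - k))"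
proof -
  define r where "r = 8 / (5 * (3 - k))"
  have "u * (8 / (5 * u)) = 8/5" if "u \<noteq> 0" for u :: real using that by simp
  from this[of "3 - k"] have "(3 - k) * r = 8/5" using k by (simp add: r_def)
  hence eq: "3 * r - k * r = 8/5" by (simp add: left_diff_distrib)
  \<comment> \<open>\<open>k = 23/17\<close> is the value at which \<open>r\<close> equals 34/35,
    the bound needed for a decreasing slope.\<close>
  have r: "r \<le> 34/35" "0 < r" using assms by (simp_all add: r_def field_simps)
  have "q \<le> r" if H: "\<forall>x\<in>{0<..<pi/2}. M k (cos x) q < sin x / x"
  proof (rule ccontr)
    assume "\<not> q \<le> r"
    hence q: "r < q" "0 < q" using r by auto
    have "(3 - k) * r < (3 - k) * q" using q k by (intro mult_strict_left_mono) auto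
    hence "0 < 1 * (3 * q - k * q - 8/5)" using eq by (simp add: algebra_simps)
    then obtain x where x: "0 < x" "x < pi/2" "0 < 1 * mean_gap (k * q) q x"
      by (rule ex_sign_mean_gap_near_0[rotated 2]) (use k q in auto)
    thus False using H sinc_less_M_iff(2)[OF k q(2) x(1,2)] by auto
  qed
  moreover have "M k (cos x) q < sin x / x" if "q \<le> r" and x: "x \<in> {0<..<pi/2}" for x
  proof -
    have "0 < (-1) * mean_gap (k * r) r x"
      using k r eq x slope_greater[of r] by (intro sign_mean_gap_of_sign_slope sign_slope_of_mono) auto
    hence "M k (cos x) r < sin x / x"
      using x sinc_less_M_iff(2)[OF k r(2)] by simp
    moreover have "M k (cos x) q \<le> M k (cos x) r"
      using x trig_pos[of x] r \<open>q \<le> r\<close> by (intro M_mono k) auto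
    ultimately show ?thesis by simp
  qed
  ultimately show ?thesis unfolding r_def by blast
qed

theorem theorem6:
  fixes k q :: real
  assumes "0 < k" and "k < 3"
  shows "(7/5 \<le> k \<longrightarrow>
            ((\<forall>x\<in>{0<..<pi/2}. sin x / x < M k (cos x) q) \<longleftrightarrow> q \<ge> 8 / (5 * (3 - k))))
       \<and> (p0 < k \<longrightarrow>
            ((\<forall>x\<in>{0<..<pi/2}. M k (cos x) q < sin x / x) \<longleftrightarrow>
               q \<le> ln (1 - k/3) / (k * ln (2/pi))))
       \<and> (k \<le> 23/17 \<longrightarrow>
            ((\<forall>x\<in>{0<..<pi/2}. M k (cos x) q < sin x / x) \<longleftrightarrow> q \<le> 8 / (5 * (3 - k))))
       \<and> (k < p0_star \<longrightarrow>
            ((\<forall>x\<in>{0<..<pi/2}. sin x / x < M k (cos x) q) \<longleftrightarrow>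
               q \<ge> ln (1 - k/3) / (k * ln (2/pi))))"
  using sinc_less_M_iff_order_ge[OF assms] M_less_sinc_iff_order_le_end[OF assms] M_less_sinc_iff_order_le[OF assms] sinc_less_M_iff_order_ge_end[OF assms] by blast

end
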